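(* Let $\Gamma$ be a finitely generated torsion-free group that has Borel's property. Then $\Gamma$ contains a nonabelian free group or $\Gamma$ is a free abelian group.
   Context: A group $\Gamma$ has Borel's property if for every connected semisimple linear algebraic group $G$ over $\mathbb{C}$, every proper (Zariski-closed) subvariety $V$ of $G$, and every element $\gamma\ne 1$ of infinite order in $\Gamma$, there exists a homomorphism $\phi\colon\Gamma\to G(\mathbb{C})$ such that $\phi(\gamma)\notin V(\mathbb{C})$. *)

theory Defs
  imports
    "HOL-Algebra.Solvable_Groups"
    "HOL-Algebra.Multiplicative_Group"
    "HOL-Algebra.Free_Abelian_Groups"
    "HOL-Analysis.Abstract_Topology"
    "Jordan_Normal_Form.Matrix"
begin

section \<open>Linear algebraic groups over the complex numbers\<close>

text \<open>
  A linear algebraic group over the (algebraically closed) field of complex numbers is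
  identified with its group of complex points, a Zariski-closed subgroup of some
  \<open>GL n\<close>.  Likewise a closed subvariety is identified with its set of complex points.
\<close>

definition GL :: "nat \<Rightarrow> complex mat monoid" where
  "GL n = units_of (ring_mat TYPE(complex) n ())"

inductive_set polynomial_functions :: "nat \<Rightarrow> (complex mat \<Rightarrow> complex) set" for n :: nat where
  const: "(\<lambda>A. c) \<in> polynomial_functions n"
| entry: "i < n \<Longrightarrow> j < n \<Longrightarrow> (\<lambda>A. A $$ (i, j)) \<in> polynomial_functions n"
| add: "f \<in> polynomial_functions n \<Longrightarrow> g \<in> polynomial_functions n \<Longrightarrow>
    (\<lambda>A. f A + g A) \<in> polynomial_functions n"
| mult: "f \<in> polynomial_functions n \<Longrightarrow> g \<in> polynomial_functions n \<Longrightarrow>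
    (\<lambda>A. f A * g A) \<in> polynomial_functions n"

definition zero_locus :: "nat \<Rightarrow> (complex mat \<Rightarrow> complex) set \<Rightarrow> complex mat set" where
  "zero_locus n F = {A \<in> carrier_mat n n. \<forall>f\<in>F. f A = 0}"

text \<open>The Zariski topology on the affine space of \<open>n\<close> by \<open>n\<close> matrices.\<close>

definition zariski :: "nat \<Rightarrow> complex mat topology" where
  "zariski n = topology (\<lambda>U. \<exists>F \<subseteq> polynomial_functions n. U = carrier_mat n n - zero_locus n F)"

lemma openin_zariski:
  "openin (zariski n) U \<longleftrightarrow> (\<exists>F \<subseteq> polynomial_functions n. U = carrier_mat n n - zero_locus n F)"
proof -
  let ?P = "polynomial_functions n"
  let ?L = "\<lambda>U. \<exists>F \<subseteq> ?P. U = carrier_mat n n - zero_locus n F"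
  have "istopology ?L"
    unfolding istopology_def
  proof (intro conjI allI impI)
    fix S T assume "?L S" "?L T"
    then obtain F G where F: "F \<subseteq> ?P" "S = carrier_mat n n - zero_locus n F"
      and G: "G \<subseteq> ?P" "T = carrier_mat n n - zero_locus n G" by blast
    let ?H = "{\<lambda>A. f A * g A | f g. f \<in> F \<and> g \<in> G}"
    have "?H \<subseteq> ?P" using F(1) G(1) by (auto intro: polynomial_functions.mult)
    moreover have "A \<in> S \<inter> T \<longleftrightarrow> A \<in> carrier_mat n n - zero_locus n ?H" for A
    proof
      assume "A \<in> S \<inter> T"
      then obtain f g where A: "A \<in> carrier_mat n n" "f \<in> F" "g \<in> G" "f A \<noteq> 0" "g A \<noteq> 0"
        unfolding F(2) G(2) zero_locus_def by blast
      have "(\<lambda>A. f A * g A) \<in> ?H" using A(2,3) by blast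
      moreover have "h A = 0" if "A \<in> zero_locus n H" "h \<in> H" for h H
        using that unfolding zero_locus_def by blast
      ultimately have "f A * g A = 0" if "A \<in> zero_locus n ?H"
        using that by (metis (lifting))
      with A show "A \<in> carrier_mat n n - zero_locus n ?H" by auto
    qed (auto simp: F(2) G(2) zero_locus_def)
    then have "S \<inter> T = carrier_mat n n - zero_locus n ?H" by blast
    ultimately show "?L (S \<inter> T)" by blast
  next
    fix \<K> assume "\<forall>K\<in>\<K>. ?L K"
    then have "\<forall>K\<in>\<K>. \<exists>F. F \<subseteq> ?P \<and> K = carrier_mat n n - zero_locus n F" by blast
    from bchoice[OF this] obtain F
      where F: "\<And>K. K \<in> \<K> \<Longrightarrow> F K \<subseteq> ?P \<and> K = carrier_mat n n - zero_locus n (F K)" by blast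
    have "\<Union> \<K> = (\<Union>K\<in>\<K>. carrier_mat n n - zero_locus n (F K))"
      using F by (metis (no_types, lifting) SUP_cong image_ident)
    also have "\<dots> = carrier_mat n n - zero_locus n (\<Union>K\<in>\<K>. F K)"
      unfolding zero_locus_def by auto
    finally show "?L (\<Union> \<K>)" using F by (intro exI[of _ "\<Union>K\<in>\<K>. F K"]) blast
  qed
  then show ?thesis unfolding zariski_def by simp
qed

lemma topspace_zariski: "topspace (zariski n) = carrier_mat n n"
proof
  show "topspace (zariski n) \<subseteq> carrier_mat n n"
    unfolding topspace_def openin_zariski by auto
  have "openin (zariski n) (carrier_mat n n)"
    unfolding openin_zariski zero_locus_def
    by (intro exI[of _ "{\<lambda>A. 1}"]) (auto intro: polynomial_functions.const)
  then show "carrier_mat n n \<subseteq> topspace (zariski n)" by (rule openin_subset)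
qed

lemma closedin_zariski:
  "closedin (zariski n) C \<longleftrightarrow> (\<exists>F \<subseteq> polynomial_functions n. C = zero_locus n F)"
proof
  assume C: "closedin (zariski n) C"
  then obtain F where "F \<subseteq> polynomial_functions n" "carrier_mat n n - C = carrier_mat n n - zero_locus n F"
    unfolding closedin_def topspace_zariski openin_zariski by blast
  moreover from this have "C = zero_locus n F"
    using closedin_subset[OF C] unfolding topspace_zariski zero_locus_def by blast
  ultimately show "\<exists>F \<subseteq> polynomial_functions n. C = zero_locus n F" by blast
next
  assume "\<exists>F \<subseteq> polynomial_functions n. C = zero_locus n F"
  then show "closedin (zariski n) C"
    unfolding closedin_def topspace_zariski openin_zariski zero_locus_def by blast
qed

definition linear_algebraic_group :: "nat \<Rightarrow> complex mat set \<Rightarrow> bool" where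
  "linear_algebraic_group n G \<longleftrightarrow>
     subgroup G (GL n) \<and> closedin (subtopology (zariski n) (carrier (GL n))) G"

definition closed_subvariety :: "nat \<Rightarrow> complex mat set \<Rightarrow> complex mat set \<Rightarrow> bool" where
  "closed_subvariety n G V \<longleftrightarrow> closedin (subtopology (zariski n) G) V"

text \<open>
  The radical, i.e. the largest closed connected solvable normal subgroup, is trivial.
\<close>

definition semisimple :: "nat \<Rightarrow> complex mat set \<Rightarrow> bool" where
  "semisimple n G \<longleftrightarrow>
     (\<forall>R. R \<lhd> (GL n)\<lparr>carrier := G\<rparr> \<longrightarrow> closed_subvariety n G R \<longrightarrow> connectedin (zariski n) R \<longrightarrow>
        solvable ((GL n)\<lparr>carrier := R\<rparr>) \<longrightarrow> R = {\<one>\<^bsub>GL n\<^esub>})"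


section \<open>Borel's property\<close>

text \<open>In HOL-Algebra, \<open>ord x = 0\<close> means that \<open>x\<close> has infinite order.\<close>

definition borel_property :: "('a, 'b) monoid_scheme \<Rightarrow> bool" where
  "borel_property \<Gamma> \<longleftrightarrow>
     (\<forall>n G V \<gamma>. linear_algebraic_group n G \<longrightarrow> connectedin (zariski n) G \<longrightarrow> semisimple n G \<longrightarrow>
        closed_subvariety n G V \<longrightarrow> V \<noteq> G \<longrightarrow>
        \<gamma> \<in> carrier \<Gamma> \<longrightarrow> \<gamma> \<noteq> \<one>\<^bsub>\<Gamma>\<^esub> \<longrightarrow> group.ord \<Gamma> \<gamma> = 0 \<longrightarrow>
        (\<exists>\<phi> \<in> hom \<Gamma> ((GL n)\<lparr>carrier := G\<rparr>). \<phi> \<gamma> \<notin> V))"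


section \<open>Finitely generated, torsion-free and free groups\<close>

definition finitely_generated_group :: "('a, 'b) monoid_scheme \<Rightarrow> bool" where
  "finitely_generated_group \<Gamma> \<longleftrightarrow>
     (\<exists>S. finite S \<and> S \<subseteq> carrier \<Gamma> \<and> generate \<Gamma> S = carrier \<Gamma>)"

definition torsion_free_group :: "('a, 'b) monoid_scheme \<Rightarrow> bool" where
  "torsion_free_group \<Gamma> \<longleftrightarrow> (\<forall>x \<in> carrier \<Gamma>. x \<noteq> \<one>\<^bsub>\<Gamma>\<^esub> \<longrightarrow> group.ord \<Gamma> x = 0)"

text \<open>
  The free group on \<open>X\<close> consists of the reduced words in the letters \<open>(x, True)\<close>, standing
  for \<open>x\<close>, and \<open>(x, False)\<close>, standing for the inverse of \<open>x\<close>.  Words are multiplied by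
  concatenation followed by free reduction; \<open>push a w\<close> is the reduced form of \<open>a # w\<close>
  for reduced \<open>w\<close>.
\<close>

definition inv_letter :: "'a \<times> bool \<Rightarrow> 'a \<times> bool" where
  "inv_letter a = (fst a, \<not> snd a)"

definition reduced :: "('a \<times> bool) list \<Rightarrow> bool" where
  "reduced w \<longleftrightarrow> successively (\<lambda>a b. b \<noteq> inv_letter a) w"

fun push :: "'a \<times> bool \<Rightarrow> ('a \<times> bool) list \<Rightarrow> ('a \<times> bool) list" where
  "push a [] = [a]"
| "push a (b # w) = (if b = inv_letter a then w else a # b # w)"

definition free_group :: "'a set \<Rightarrow> ('a \<times> bool) list monoid" where
  "free_group X =
     \<lparr>carrier = {w. reduced w \<and> fst ` set w \<subseteq> X},
      monoid.mult = (\<lambda>v w. foldr push v w),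
      one = []\<rparr>"

lemma inv_letter_inv_letter [simp]: "inv_letter (inv_letter a) = a"
  by (simp add: inv_letter_def)

lemma reduced_push: "reduced w \<Longrightarrow> reduced (push a w)"
  by (cases w) (auto simp: reduced_def successively_Cons)

lemma push_inv_push: "reduced w \<Longrightarrow> push (inv_letter a) (push a w) = w"
  by (cases w; cases "tl w") (auto simp: reduced_def)

lemma reduced_foldr_push: "reduced w \<Longrightarrow> reduced (foldr push v w)"
  by (induction v) (auto intro: reduced_push)

lemma foldr_push_push: "reduced w \<Longrightarrow> foldr push (push a v) w = push a (foldr push v w)"
  by (cases v) (auto, metis inv_letter_inv_letter push_inv_push reduced_foldr_push)

lemma foldr_push_assoc:
  "reduced w \<Longrightarrow> foldr push (foldr push u v) w = foldr push u (foldr push v w)"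
  by (induction u) (auto simp: foldr_push_push)

lemma set_push: "set (push a w) \<subseteq> insert a (set w)"
  by (cases w) auto

lemma set_foldr_push: "set (foldr push v w) \<subseteq> set v \<union> set w"
  by (induction v) (use set_push in fastforce)+

lemma foldr_push_inverse:
  "reduced w \<Longrightarrow> foldr push (map inv_letter (rev v)) (foldr push v w) = w"
  by (induction v) (auto simp: push_inv_push reduced_foldr_push)

lemma foldr_push_Nil: "reduced w \<Longrightarrow> foldr push w [] = w"
proof (induction w)
  case (Cons a w)
  then show ?case by (cases w) (auto simp: reduced_def)
qed simp

lemma group_free_group: "group (free_group X)"
proof (rule groupI)
  fix w assume w: "w \<in> carrier (free_group X)"
  let ?v = "foldr push (map inv_letter (rev w)) []"
  have "reduced ?v" by (rule reduced_foldr_push) (simp add: reduced_def)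
  moreover have "set ?v \<subseteq> inv_letter ` set w"
    using set_foldr_push[of "map inv_letter (rev w)" "[]"] by auto
  then have "fst ` set ?v \<subseteq> X"
    using w by (force simp: free_group_def inv_letter_def)
  moreover have "foldr push ?v w = []"
  proof -
    have "foldr push ?v w = foldr push (map inv_letter (rev w)) w"
      using w foldr_push_assoc[of w "map inv_letter (rev w)" "[]"] by (simp add: free_group_def)
    also have "\<dots> = foldr push (map inv_letter (rev w)) (foldr push w [])"
      using w by (simp add: foldr_push_Nil free_group_def)
    also have "\<dots> = []" by (rule foldr_push_inverse) (simp add: reduced_def)
    finally show ?thesis .
  qed
  ultimately show "\<exists>v\<in>carrier (free_group X). v \<otimes>\<^bsub>free_group X\<^esub> w = \<one>\<^bsub>free_group X\<^esub>"
    by (intro bexI[of _ ?v]) (auto simp: free_group_def)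
next
  fix v w assume "v \<in> carrier (free_group X)" "w \<in> carrier (free_group X)"
  then show "v \<otimes>\<^bsub>free_group X\<^esub> w \<in> carrier (free_group X)"
    using set_foldr_push[of v w] by (force simp: free_group_def reduced_foldr_push)
qed (auto simp: free_group_def foldr_push_assoc reduced_def)

text \<open>
  In the following definitions it is enough to consider bases \<open>X\<close> in the type of the group
  elements, since a basis embeds in its (abelian) free group.
\<close>

definition is_free_group :: "('a, 'b) monoid_scheme \<Rightarrow> bool" where
  "is_free_group H \<longleftrightarrow> (\<exists>X :: 'a set. H \<cong> free_group X)"

definition is_free_abelian_group :: "('a, 'b) monoid_scheme \<Rightarrow> bool" where
  "is_free_abelian_group H \<longleftrightarrow> (\<exists>X :: 'a set. H \<cong> free_Abelian_group X)"

definition contains_nonabelian_free_group :: "('a, 'b) monoid_scheme \<Rightarrow> bool" where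
  "contains_nonabelian_free_group \<Gamma> \<longleftrightarrow>
     (\<exists>H. subgroup H \<Gamma> \<and> is_free_group (\<Gamma>\<lparr>carrier := H\<rparr>) \<and> \<not> comm_group (\<Gamma>\<lparr>carrier := H\<rparr>))"

end

theory Submission
  imports
    Defs
    "HOL-Analysis.Abstract_Topological_Spaces"
    "HOL-Computational_Algebra.Fundamental_Theorem_Algebra"
    "Jordan_Normal_Form.Column_Operations"
    "Jordan_Normal_Form.Determinant"
begin

text \<open>
  Suppose that the group has no nonabelian free subgroup.

  Borel's property for \<open>SL 2\<close> shows that all squares commute.  Otherwise let \<open>\<gamma>\<close> be a nontrivial
  commutator of two squares \<open>a\<^sup>2\<close>, \<open>b\<^sup>2\<close>; there are representations for which \<open>\<gamma>\<close> has an eigenvalue \<open>z\<close>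
  outside any given finite set.  In such a representation some \<open>g\<close> from a fixed finite list of words
  moves the pair of eigenlines of \<open>\<gamma>\<close> off itself, since otherwise \<open>a\<close> and \<open>b\<close> would be simultaneously
  triangular or monomial.  Up to conjugation the pair \<open>(\<gamma>, g \<gamma> g\<^sup>-\<^sup>1)\<close> depends only on \<open>z\<close> and a
  cross ratio \<open>c \<notin> {0, 1}\<close>, and relations between \<open>\<gamma>\<^sup>n\<close> and \<open>g \<gamma>\<^sup>n g\<^sup>-\<^sup>1\<close> become polynomial equations in \<open>(z, c)\<close>.
  As infinitely many \<open>z\<close> occur for a single \<open>g\<close>, these equations have a common solution with \<open>\<bar>z\<bar> > 1\<close>,
  against ping-pong on the complex projective line.

  Borel's property for \<open>SL 3\<close> shows that \<open>g\<close> commutes with \<open>s\<close> as soon as \<open>g\<^sup>2\<close> does: \<open>g\<close> swaps \<open>s\<close> and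
  \<open>t = g s g\<^sup>-\<^sup>1\<close>, so it negates the difference of their images, which is therefore singular in odd
  dimension, and \<open>s t\<^sup>-\<^sup>1\<close> has the eigenvalue \<open>1\<close> in every representation.  Applied twice to
  commuting squares, this makes the group abelian.
\<close>

section \<open>Free subgroups and ping-pong\<close>

definition letter_val :: "('a, 'b) monoid_scheme \<Rightarrow> 'a \<times> bool \<Rightarrow> 'a" where
  "letter_val G l = (if snd l then fst l else inv\<^bsub>G\<^esub> (fst l))"

definition word_val :: "('a, 'b) monoid_scheme \<Rightarrow> ('a \<times> bool) list \<Rightarrow> 'a" where
  "word_val G w = foldr (\<lambda>l r. letter_val G l \<otimes>\<^bsub>G\<^esub> r) w \<one>\<^bsub>G\<^esub>"

lemma word_val_simps [simp]:
  "word_val G [] = \<one>\<^bsub>G\<^esub>"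
  "word_val G (l # w) = letter_val G l \<otimes>\<^bsub>G\<^esub> word_val G w"
  by (simp_all add: word_val_def)

context group
begin

lemma letter_val_closed: "fst l \<in> carrier G \<Longrightarrow> letter_val G l \<in> carrier G"
  by (simp add: letter_val_def)

lemma word_val_closed: "fst ` set w \<subseteq> carrier G \<Longrightarrow> word_val G w \<in> carrier G"
  by (induction w) (auto intro: letter_val_closed)

lemma letter_val_inv_letter:
  "fst l \<in> carrier G \<Longrightarrow> letter_val G (inv_letter l) = inv (letter_val G l)"
  by (simp add: letter_val_def inv_letter_def)

lemma word_val_push:
  assumes "fst l \<in> carrier G" "fst ` set w \<subseteq> carrier G"
  shows "word_val G (push l w) = letter_val G l \<otimes> word_val G w"
proof (cases w)
  case (Cons m v)
  then have "letter_val G l \<otimes> (letter_val G (inv_letter l) \<otimes> word_val G v) = word_val G v"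
    using assms letter_val_closed[of l] word_val_closed[of v]
    by (simp add: letter_val_inv_letter flip: m_assoc)
  then show ?thesis using Cons by simp
qed simp

lemma word_val_foldr_push:
  assumes "fst ` set v \<subseteq> carrier G" "fst ` set w \<subseteq> carrier G"
  shows "word_val G (foldr push v w) = word_val G v \<otimes> word_val G w"
  using assms(1)
proof (induction v)
  case Nil
  then show ?case using word_val_closed[OF assms(2)] by simp
next
  case (Cons l v)
  moreover have "fst ` set (foldr push v w) \<subseteq> carrier G"
    using set_foldr_push[of v w] Cons.prems assms(2) by fastforce
  ultimately show ?case
    using word_val_closed assms(2) letter_val_closed by (simp add: word_val_push m_assoc)
qed

text \<open>Evaluation of words is a homomorphism from the free group on the two letters. The
  hypothesis makes its kernel trivial, so its image is the free subgroup sought.\<close>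

lemma contains_nonabelian_free_groupI:
  assumes xy: "x \<in> carrier G" "y \<in> carrier G" "x \<noteq> y"
    and nontriv: "\<And>w. reduced w \<Longrightarrow> w \<noteq> [] \<Longrightarrow> fst ` set w \<subseteq> {x, y} \<Longrightarrow> word_val G w \<noteq> \<one>"
  shows "contains_nonabelian_free_group G"
proof -
  let ?F = "free_group {x, y}"
  have F: "carrier ?F = {w. reduced w \<and> fst ` set w \<subseteq> {x, y}}" "\<one>\<^bsub>?F\<^esub> = []"
    "v \<otimes>\<^bsub>?F\<^esub> w = foldr push v w" for v w
    by (simp_all add: free_group_def)
  have sub: "fst ` set w \<subseteq> carrier G" if "w \<in> carrier ?F" for w
    using that xy by (auto simp: F)
  have hom: "word_val G \<in> hom ?F G"
    by (rule homI) (auto simp: F(3) word_val_closed sub word_val_foldr_push)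
  interpret h: group_hom ?F G "word_val G"
    using hom group_free_group is_group by (simp add: group_hom_def group_hom_axioms_def)
  have "kernel ?F G (word_val G) = {\<one>\<^bsub>?F\<^esub>}"
    using nontriv by (auto simp: kernel_def F reduced_def)
  then have inj: "inj_on (word_val G) (carrier ?F)" by (rule h.trivial_ker_imp_inj)
  let ?H = "word_val G ` carrier ?F"
  have H: "subgroup ?H G" by (rule h.img_is_subgroup)
  have "word_val G \<in> iso ?F (G\<lparr>carrier := ?H\<rparr>)"
    using hom inj by (auto simp: iso_def hom_def bij_betw_def)
  then have "G\<lparr>carrier := ?H\<rparr> \<cong> ?F"
    by (intro group.iso_sym[OF group_free_group] is_isoI)
  moreover have "\<not> comm_group (G\<lparr>carrier := ?H\<rparr>)"
  proof
    assume "comm_group (G\<lparr>carrier := ?H\<rparr>)"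
    then interpret H: comm_group "G\<lparr>carrier := ?H\<rparr>" .
    have "[(x, True)] \<in> carrier ?F" "[(y, True)] \<in> carrier ?F"
      by (auto simp: F reduced_def)
    then have "word_val G [(x, True)] \<in> ?H" "word_val G [(y, True)] \<in> ?H" by blast+
    then have "x \<otimes> y = y \<otimes> x"
      using H.m_comm[of x y] xy by (simp add: letter_val_def)
    \<comment> \<open>If the image were commutative, the commutator of \<open>x\<close> and
      \<open>y\<close> would be a nonempty reduced word of value one.\<close>
    then have "word_val G [(x, True), (y, True), (x, False), (y, False)] = \<one>"
      using xy by (simp add: letter_val_def flip: m_assoc) (simp add: m_assoc)
    then show False
      using nontriv[of "[(x, True), (y, True), (x, False), (y, False)]"] xy(3)
      by (auto simp: reduced_def inv_letter_def)
  qed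
  ultimately show ?thesis
    unfolding contains_nonabelian_free_group_def is_free_group_def using H by blast
qed

end

text \<open>The letter \<open>l\<close> attracts towards \<open>U l\<close>. In a reduced word the
  next letter \<open>m\<close> is never the inverse of \<open>l\<close>, so by disjointness
  \<open>U m\<close> lies in the region that \<open>l\<close> moves into \<open>U l\<close>. In the
  application \<open>V\<close> excludes the zero vector.\<close>

lemma ping_pong:
  assumes move: "\<And>l v. fst l \<in> X \<Longrightarrow> v \<notin> U (inv_letter l) \<Longrightarrow> v \<in> V \<Longrightarrow> f l v \<in> U l \<inter> V"
    and disj: "\<And>l m. fst l \<in> X \<Longrightarrow> fst m \<in> X \<Longrightarrow> l \<noteq> m \<Longrightarrow> U l \<inter> U m = {}"
    and base: "v \<in> V" "\<And>l. fst l \<in> X \<Longrightarrow> v \<notin> U l"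
    and w: "reduced w" "w \<noteq> []" "fst ` set w \<subseteq> X"
  shows "foldr f w v \<in> U (hd w) \<inter> V"
  using w
proof (induction w)
  case (Cons l w)
  have inv: "fst (inv_letter l) \<in> X" using Cons.prems by (simp add: inv_letter_def)
  show ?case
  proof (cases w)
    case Nil
    then show ?thesis using move base Cons.prems inv by simp
  next
    case (Cons m u)
    then have "foldr f w v \<in> U m \<inter> V" "m \<noteq> inv_letter l" "fst m \<in> X"
      using Cons.IH Cons.prems by (auto simp: reduced_def)
    then have "foldr f w v \<notin> U (inv_letter l)" using disj[OF _ inv, of m] by blast
    then show ?thesis using move Cons.prems \<open>foldr f w v \<in> U m \<inter> V\<close> by simp
  qed
qed simp

section \<open>Two by two matrices and words in two conjugate diagonalizable matrices\<close>

definition mat2 :: "'a \<Rightarrow> 'a \<Rightarrow> 'a \<Rightarrow> 'a \<Rightarrow> 'a mat" where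
  "mat2 a b c d = Matrix.mat 2 2 (\<lambda>(i, j). if i = 0 then if j = 0 then a else b else if j = 0 then c else d)"

lemma mat2_carrier [simp]: "mat2 a b c d \<in> carrier_mat 2 2"
  by (simp add: mat2_def)

lemma mat2_index [simp]:
  "mat2 a b c d $$ (0, 0) = a" "mat2 a b c d $$ (0, Suc 0) = b"
  "mat2 a b c d $$ (Suc 0, 0) = c" "mat2 a b c d $$ (Suc 0, Suc 0) = d"
  by (simp_all add: mat2_def)

lemma mat2_eq_iff:
  "mat2 a b c d = mat2 a' b' c' d' \<longleftrightarrow> a = a' \<and> b = b' \<and> c = c' \<and> d = d'"
  using mat2_index by metis

lemma mat2_exhaust:
  assumes "A \<in> carrier_mat 2 2"
  shows "A = mat2 (A $$ (0, 0)) (A $$ (0, 1)) (A $$ (1, 0)) (A $$ (1, 1))"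
  using assms by (intro eq_matI) (auto simp: less_2_cases_iff mat2_def)

lemma mat2_mult:
  "mat2 a b c d * mat2 a' b' c' d' =
    mat2 (a * a' + b * c') (a * b' + b * d') (c * a' + d * c') (c * b' + d * d')"
  for a :: "'a :: semiring_0"
  by (intro eq_matI)
    (auto simp: less_2_cases_iff mat2_def scalar_prod_def numeral_2_eq_2)

lemma one_mat2: "1\<^sub>m 2 = mat2 1 0 0 1"
  by (intro eq_matI) (auto simp: less_2_cases_iff mat2_def)

lemma det_mat2: "det (mat2 a b c d) = a * d - b * c" for a :: "'a :: comm_ring_1"
proof -
  have "det (mat2 a b c d) = (\<Sum>j<2. mat2 a b c d $$ (0, j) * cofactor (mat2 a b c d) 0 j)"
    by (rule laplace_expansion_row) simp_all
  moreover have "det (mat_delete (mat2 a b c d) 0 0) = d" "det (mat_delete (mat2 a b c d) 0 1) = c"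
    by (subst det_single; simp add: mat2_def mat_delete_def)+
  ultimately show ?thesis
    by (simp add: lessThan_Suc numeral_2_eq_2 cofactor_def)
qed

definition act2 :: "'a :: semiring_0 mat \<Rightarrow> 'a \<times> 'a \<Rightarrow> 'a \<times> 'a" where
  "act2 A v = (A $$ (0, 0) * fst v + A $$ (0, 1) * snd v, A $$ (1, 0) * fst v + A $$ (1, 1) * snd v)"

lemma act2_mat2 [simp]: "act2 (mat2 a b c d) (x, y) = (a * x + b * y, c * x + d * y)"
  by (simp add: act2_def)

lemma act2_mult:
  fixes A :: "'a :: semiring_0 mat"
  assumes "A \<in> carrier_mat 2 2" "B \<in> carrier_mat 2 2"
  shows "act2 (A * B) v = act2 A (act2 B v)"
proof -
  obtain x y where "v = (x, y)" by force
  then show ?thesis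
    by (subst (1 2) mat2_exhaust[OF assms(1)], subst (1 2) mat2_exhaust[OF assms(2)])
      (simp add: mat2_mult algebra_simps)
qed

text \<open>\<open>hyp_conj \<mu> c\<close> is the conjugate of \<open>hyp \<mu>\<close> by the matrix \<open>mat2 c (c - 1) 1 1\<close>.\<close>

definition hyp :: "complex \<Rightarrow> complex mat" where
  "hyp \<mu> = mat2 \<mu> 0 0 (1 / \<mu>)"

definition hyp_conj :: "complex \<Rightarrow> complex \<Rightarrow> complex mat" where
  "hyp_conj \<mu> c = mat2 (c * \<mu> - (c - 1) / \<mu>) (c * (1 - c) * (\<mu> - 1 / \<mu>))
     (\<mu> - 1 / \<mu>) ((1 - c) * \<mu> + c / \<mu>)"

definition hyp_letter :: "'a \<Rightarrow> complex \<Rightarrow> complex \<Rightarrow> 'a \<times> bool \<Rightarrow> complex mat" where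
  "hyp_letter x \<mu> c l = (let \<nu> = if snd l then \<mu> else 1 / \<mu> in if fst l = x then hyp \<nu> else hyp_conj \<nu> c)"

definition hyp_word :: "'a \<Rightarrow> complex \<Rightarrow> complex \<Rightarrow> ('a \<times> bool) list \<Rightarrow> complex mat" where
  "hyp_word x \<mu> c w = foldr (\<lambda>l M. hyp_letter x \<mu> c l * M) w (1\<^sub>m 2)"

lemma hyp_letter_carrier [simp]: "hyp_letter x \<mu> c l \<in> carrier_mat 2 2"
  by (simp add: hyp_letter_def hyp_def hyp_conj_def Let_def)

lemma hyp_word_carrier [simp]: "hyp_word x \<mu> c w \<in> carrier_mat 2 2"
  by (induction w) (auto simp: hyp_word_def intro!: mult_carrier_mat[of _ 2 2])

lemma act2_hyp_word:
  "act2 (hyp_word x \<mu> c w) v = foldr (\<lambda>l. act2 (hyp_letter x \<mu> c l)) w v"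
proof (induction w)
  case Nil
  then show ?case by (cases v) (simp add: hyp_word_def one_mat2)
next
  case (Cons l w)
  then show ?case
    using act2_mult[OF hyp_letter_carrier hyp_word_carrier, of x \<mu> c l x \<mu> c w v]
    by (simp add: hyp_word_def)
qed

text \<open>\<open>ginv\<close> is the inverse of \<open>mat2 c (c - 1) 1 1\<close>: it passes to
  coordinates in the eigenbasis of \<open>hyp_conj\<close>. The first four bounds on
  \<open>R\<close> separate cones around the eigenlines of (1, 0), (0, 1), (c, 1), (c - 1, 1); those
  on \<open>t\<close> keep the base vector (t, 1) outside all of them.\<close>

lemma hyp_letters_ping_pong:
  fixes c \<mu> :: complex and R :: real
  defines "ginv \<equiv> \<lambda>v :: complex \<times> complex. (fst v + (1 - c) * snd v, c * snd v - fst v)"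
  assumes R: "R \<ge> 4" "R \<ge> 2 * (1 + norm c + norm (1 - c))"
    and Rc: "R * norm c \<ge> 2 * (1 + norm (1 - c))" "R * norm (1 - c) \<ge> 2 * (1 + norm c)"
    and t: "norm t \<le> R" "1 \<le> R * norm t" "norm (t + (1 - c)) \<le> R * norm (c - t)"
      "norm (c - t) \<le> R * norm (t + (1 - c))"
    and \<mu>: "norm \<mu> > R"
    and w: "reduced w" "w \<noteq> []" "fst ` set w \<subseteq> {x, y}" and "x \<noteq> y"
  shows "hyp_word x \<mu> c w \<noteq> 1\<^sub>m 2"
proof
  \<comment> \<open>Cones around the first axis (\<open>True\<close>) and the second
    (\<open>False\<close>). \<open>U\<close> uses them in the eigenbasis of the letter, whose sign
    selects the expanded axis.\<close>
  define W where "W s = {v :: complex \<times> complex. if s then norm (fst v) > R * norm (snd v)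
      else norm (snd v) > R * norm (fst v)}" for s
  define U where "U l = {v. (if fst l = x then v else ginv v) \<in> W (snd l)}" for l :: "'a \<times> bool"
  have "\<mu> \<noteq> 0" using \<mu> R(1) by auto
  \<comment> \<open>The quotient of the coordinates changes by the square of \<mu> or of its
    inverse. As the norm of \<mu> exceeds \<open>R\<close>, the complement of one cone goes into the
    other.\<close>
  have W_move: "(\<nu> * a, b / \<nu>) \<in> W s"
    if "(a, b) \<notin> W (\<not> s)" "(a, b) \<noteq> (0, 0)" "\<nu> = (if s then \<mu> else 1 / \<mu>)" for a b \<nu> s
  proof -
    have "norm a * norm \<mu> > R * (norm b / norm \<mu>)" if "norm b \<le> R * norm a" "(a, b) \<noteq> (0, 0)" for a b :: complex
    proof -
      have "a \<noteq> 0" using that by auto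
      have "R * norm b \<le> R * (R * norm a)"
        using that R by (intro mult_left_mono) auto
      also have "\<dots> < norm \<mu> * (norm \<mu> * norm a)"
        using \<open>a \<noteq> 0\<close> \<open>\<mu> \<noteq> 0\<close> \<mu> R by (intro mult_strict_mono mult_strict_right_mono) auto
      finally show ?thesis using \<open>\<mu> \<noteq> 0\<close> by (simp add: field_simps)
    qed
    note this[of b a] this[of a b]
    then show ?thesis
      using that by (cases s) (auto simp: W_def norm_mult norm_divide field_simps not_less)
  qed
  show False if "hyp_word x \<mu> c w = 1\<^sub>m 2"
  proof -
    have "foldr (\<lambda>l. act2 (hyp_letter x \<mu> c l)) w (t, 1) \<in> U (hd w) \<inter> (- {(0, 0)})"
    proof (rule ping_pong[where X = "{x, y}"])
      fix l :: "'a \<times> bool" and v assume l: "fst l \<in> {x, y}" "v \<notin> U (inv_letter l)" "v \<in> - {(0, 0)}"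
      obtain a b where v: "v = (a, b)" by force
      define \<nu> where "\<nu> = (if snd l then \<mu> else 1 / \<mu>)"
      have "\<nu> \<noteq> 0" using \<open>\<mu> \<noteq> 0\<close> by (simp add: \<nu>_def)
      have "(0, 0) \<notin> U l" by (auto simp: U_def W_def ginv_def)
      moreover have "act2 (hyp_letter x \<mu> c l) v \<in> U l"
      proof (cases "fst l = x")
        case True
        then show ?thesis
          using W_move[of a b "snd l" \<nu>] l
          by (simp add: U_def v inv_letter_def \<nu>_def hyp_letter_def hyp_def Let_def)
      next
        case False
        \<comment> \<open>Coordinates with respect to the eigenvectors (c, 1) and (c - 1, 1) of
          \<open>hyp_conj\<close>.\<close>
        define a' b' where "a' = a + (1 - c) * b" and "b' = c * b - a"
        have "a = c * a' + (c - 1) * b'" "b = a' + b'"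
          by (simp_all add: a'_def b'_def algebra_simps)
        then have nz: "(a', b') \<noteq> (0, 0)" using l by (auto simp: v)
        have *: "ginv (act2 (hyp_conj \<nu> c) v) = (\<nu> * a', b' / \<nu>)"
          using \<open>\<nu> \<noteq> 0\<close>
          by (simp add: v ginv_def hyp_conj_def a'_def b'_def field_simps)
        have "ginv v = (a', b')" by (simp add: ginv_def v a'_def b'_def)
        then have "(\<nu> * a', b' / \<nu>) \<in> W (snd l)"
          using l False nz by (intro W_move) (auto simp: U_def inv_letter_def \<nu>_def)
        then show ?thesis
          using False * by (simp add: U_def hyp_letter_def \<nu>_def)
      qed
      ultimately show "act2 (hyp_letter x \<mu> c l) v \<in> U l \<inter> - {(0, 0)}" by auto
    next
      fix l m :: "'a \<times> bool" assume lm: "fst l \<in> {x, y}" "fst m \<in> {x, y}" "l \<noteq> m"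
      have W_disj: "W True \<inter> W False = {}"
      proof -
        have False if "R * b < a" "R * a < b" "a \<ge> 0" "b \<ge> 0" for a b :: real
        proof -
          have "b \<le> R * b" "a \<le> R * a" using that R by (simp_all add: mult_le_cancel_right1)
          then show False using that by linarith
        qed
        then show ?thesis unfolding W_def by (auto simp: disjoint_iff) (metis norm_ge_zero)
      qed
      \<comment> \<open>Near a coordinate axis both eigencoordinates have comparable size: each is
        close to \<open>a\<close> up to sign when \<open>b\<close> is small, and to (1 - c) b and c
        b when \<open>a\<close> is small. So the vector is in neither cone of the other
        letter.\<close>
      have W_ginv: "ginv v \<notin> W s'" if v: "v \<in> W s" for v s s'
      proof -
        obtain a b where ab: "v = (a, b)" by force
        define a' b' where "a' = a + (1 - c) * b" and "b' = c * b - a"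
        have tri: "norm a' \<le> norm a + norm (1 - c) * norm b" "norm b' \<le> norm c * norm b + norm a"
          "norm a' \<ge> norm a - norm (1 - c) * norm b" "norm b' \<ge> norm a - norm c * norm b"
          "norm a' \<ge> norm (1 - c) * norm b - norm a" "norm b' \<ge> norm c * norm b - norm a"
          using norm_triangle_ineq[of a "(1 - c) * b"] norm_triangle_ineq4[of "c * b" a]
            norm_diff_ineq[of a "(1 - c) * b"] norm_triangle_ineq2[of a "c * b"]
            norm_diff_ineq[of "(1 - c) * b" a] norm_triangle_ineq2[of "c * b" a]
          by (simp_all add: a'_def b'_def norm_mult norm_minus_commute add.commute)
        have "norm a' \<le> R * norm b' \<and> norm b' \<le> R * norm a'"
        proof (cases s)
          case True
          then have "R * norm b < norm a" using v by (simp add: W_def ab)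
          moreover have "2 * (1 + norm c + norm (1 - c)) * norm b \<le> R * norm b"
            using R by (intro mult_right_mono) auto
          ultimately have "2 * (norm c * norm b) + 2 * (norm (1 - c) * norm b) \<le> norm a"
            by (simp add: algebra_simps) (use norm_ge_zero[of b] in linarith)
          moreover have "norm c * norm b \<ge> 0" "norm (1 - c) * norm b \<ge> 0" by simp_all
          moreover have "4 * norm b' \<le> R * norm b'" "4 * norm a' \<le> R * norm a'"
            using R by (intro mult_right_mono; simp)+
          ultimately show ?thesis using tri by linarith
        next
          case False
          then have b: "R * norm a < norm b" using v by (simp add: W_def ab)
          have 4: "4 * norm a \<le> R * norm a" using R by (intro mult_right_mono) auto
          have 1: "2 * (1 + norm (1 - c)) * norm b \<le> R * norm c * norm b"
            "2 * (1 + norm c) * norm b \<le> R * norm (1 - c) * norm b"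
            using Rc by (intro mult_right_mono; simp)+
          have "R * (norm c * norm b - norm a) \<le> R * norm b'"
            "R * (norm (1 - c) * norm b - norm a) \<le> R * norm a'"
            using tri R by (intro mult_left_mono; simp)+
          then show ?thesis
            using tri 1 4 b norm_ge_zero[of a] norm_ge_zero[of b] mult_nonneg_nonneg[OF norm_ge_zero norm_ge_zero, of c b]
              mult_nonneg_nonneg[OF norm_ge_zero norm_ge_zero, of "1 - c" b]
            by (simp add: algebra_simps)
        qed
        then show ?thesis by (auto simp: ginv_def ab W_def a'_def b'_def split: if_splits)
      qed
      show "U l \<inter> U m = {}"
      proof (rule ccontr)
        assume "U l \<inter> U m \<noteq> {}"
        then obtain v where v: "v \<in> U l" "v \<in> U m" by blast
        show False
        proof (cases "fst l = fst m")
          case True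
          then have "snd l = (\<not> snd m)" using lm by (auto simp: prod_eq_iff)
          then show False using v True W_disj by (cases "snd m") (auto simp: U_def)
        next
          case False
          then show False using v lm W_ginv by (auto simp: U_def split: if_splits)
        qed
      qed
    next
      fix l :: "'a \<times> bool"
      show "(t, 1) \<notin> U l" using t by (auto simp: U_def W_def ginv_def split: if_splits)
    qed (use w in auto)
    \<comment> \<open>A trivial word fixes the base vector, which lies in no
      \<open>U l\<close>.\<close>
    moreover have "act2 (hyp_word x \<mu> c w) (t, 1) = (t, 1)"
      using that by (simp add: one_mat2)
    moreover have "(t, 1) \<notin> U (hd w)" using t by (auto simp: U_def W_def ginv_def split: if_splits)
    ultimately show False by (simp add: act2_hyp_word)
  qed
qed

text \<open>The bounds of the ping-pong lemma depend only on \<open>c\<close> and an auxiliary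
  \<open>t\<close>, so a high power of \<kappa> passes all of them at once, for all words
  together.\<close>

lemma exists_free_power:
  fixes \<kappa> c :: complex
  assumes "norm \<kappa> > 1" "c \<noteq> 0" "c \<noteq> 1"
  obtains n :: nat where "n > 0"
    "\<And>(x :: 'a) y w. x \<noteq> y \<Longrightarrow> reduced w \<Longrightarrow> w \<noteq> [] \<Longrightarrow> fst ` set w \<subseteq> {x, y} \<Longrightarrow>
      hyp_word x (\<kappa> ^ n) c w \<noteq> 1\<^sub>m 2"
proof -
  \<comment> \<open>The vector (t, 1) must avoid the eigenlines of (0, 1), (c, 1) and (c - 1, 1); it
    is never on that of (1, 0).\<close>
  have "infinite (UNIV - {0, c, c - 1} :: complex set)" by (simp add: infinite_UNIV_char_0)
  then have "UNIV - {0, c, c - 1} \<noteq> {}" by (rule infinite_imp_nonempty)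
  then obtain t where t: "t \<noteq> 0" "t \<noteq> c" "t \<noteq> c - 1" by auto
  define S where "S = {4, 2 * (1 + norm c + norm (1 - c)), 2 * (1 + norm (1 - c)) / norm c,
      2 * (1 + norm c) / norm (1 - c), norm t, 1 / norm t,
      norm (t + (1 - c)) / norm (c - t), norm (c - t) / norm (t + (1 - c))}"
  define R where "R = Max S"
  have "\<And>r. r \<in> S \<Longrightarrow> r \<le> R" unfolding R_def by (rule Max_ge) (auto simp: S_def)
  then have R: "4 \<le> R" "2 * (1 + norm c + norm (1 - c)) \<le> R" "2 * (1 + norm (1 - c)) / norm c \<le> R"
      "2 * (1 + norm c) / norm (1 - c) \<le> R" "norm t \<le> R" "1 / norm t \<le> R"
      "norm (t + (1 - c)) / norm (c - t) \<le> R" "norm (c - t) / norm (t + (1 - c)) \<le> R"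
    by (simp_all add: S_def)
  have pos: "norm c > 0" "norm (1 - c) > 0" "norm t > 0" "norm (c - t) > 0" "norm (t + (1 - c)) > 0"
    using assms t by (auto simp: algebra_simps add_eq_0_iff)
  obtain n where n: "R < norm \<kappa> ^ n" using real_arch_pow[OF assms(1)] by blast
  show ?thesis
  proof (rule that[of n])
    show "n > 0" using n R(1) by (cases n) auto
    fix x y :: 'a and w
    assume "x \<noteq> y" "reduced w" "w \<noteq> []" "fst ` set w \<subseteq> {x, y}"
    then show "hyp_word x (\<kappa> ^ n) c w \<noteq> 1\<^sub>m 2"
      using R pos n by (intro hyp_letters_ping_pong[of R c t]) (simp_all add: norm_power field_simps)
  qed
qed

section \<open>Finitely generated torsion-free abelian groups\<close>

context comm_group
begin

definition power_prod :: "'a set \<Rightarrow> ('a \<Rightarrow> int) \<Rightarrow> 'a" where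
  "power_prod S m = (\<Otimes>s\<in>S. s [^] m s)"

lemma power_prod_closed: "S \<subseteq> carrier G \<Longrightarrow> power_prod S m \<in> carrier G"
  unfolding power_prod_def by (intro finprod_closed) auto

lemma power_prod_insert:
  "finite S \<Longrightarrow> insert x S \<subseteq> carrier G \<Longrightarrow> x \<notin> S \<Longrightarrow>
    power_prod (insert x S) m = x [^] m x \<otimes> power_prod S m"
  unfolding power_prod_def by (intro finprod_insert) auto

lemma power_prod_cong:
  "S \<subseteq> carrier G \<Longrightarrow> (\<And>s. s \<in> S \<Longrightarrow> m s = m' s) \<Longrightarrow> power_prod S m = power_prod S m'"
  unfolding power_prod_def by (intro finprod_cong') auto

lemma power_prod_zero:
  "S \<subseteq> carrier G \<Longrightarrow> (\<And>s. s \<in> S \<Longrightarrow> m s = 0) \<Longrightarrow> power_prod S m = \<one>"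
  unfolding power_prod_def by (intro finprod_one_eqI) auto

lemma power_prod_add:
  assumes "S \<subseteq> carrier G"
  shows "power_prod S (\<lambda>s. m s + m' s) = power_prod S m \<otimes> power_prod S m'"
proof -
  have "power_prod S (\<lambda>s. m s + m' s) = (\<Otimes>s\<in>S. s [^] m s \<otimes> s [^] m' s)"
    unfolding power_prod_def using assms by (intro finprod_cong') (auto simp: int_pow_mult)
  also have "\<dots> = power_prod S m \<otimes> power_prod S m'"
    unfolding power_prod_def using assms by (intro finprod_multf) auto
  finally show ?thesis .
qed

text \<open>Exponents define a homomorphism from the free abelian group on \<open>S\<close>;
  independence makes it injective, generation surjective.\<close>

lemma is_free_abelian_groupI:
  assumes S: "finite S" "S \<subseteq> carrier G" "generate G S = carrier G"
    and indep: "\<And>m. power_prod S m = \<one> \<Longrightarrow> \<forall>s\<in>S. m s = 0"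
  shows "is_free_abelian_group G"
proof -
  let ?F = "free_Abelian_group S"
  define h where "h f = power_prod S (Poly_Mapping.lookup f)" for f
  have hom: "h \<in> hom ?F G"
    by (rule homI) (simp_all add: h_def power_prod_closed S power_prod_add plus_poly_mapping.rep_eq)
  interpret h: group_hom ?F G h
    using hom group_free_Abelian_group is_group by (simp add: group_hom_def group_hom_axioms_def)
  have "kernel ?F G h = {\<one>\<^bsub>?F\<^esub>}"
  proof -
    have "f = 0" if "Poly_Mapping.keys f \<subseteq> S" "h f = \<one>" for f
    proof (rule poly_mapping_eqI)
      fix s
      show "Poly_Mapping.lookup f s = Poly_Mapping.lookup 0 s"
        using indep[of "Poly_Mapping.lookup f"] that by (auto simp: h_def in_keys_iff)
    qed
    then show ?thesis using h.hom_one by (auto simp: kernel_def)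
  qed
  then have "inj_on h (carrier ?F)" by (rule h.trivial_ker_imp_inj)
  moreover have "carrier G \<subseteq> h ` carrier ?F"
    unfolding S(3)[symmetric]
  proof (rule generate_subgroup_incl[OF _ h.img_is_subgroup])
    show "S \<subseteq> h ` carrier ?F"
    proof
      fix s assume s: "s \<in> S"
      have "h (frag_of s) = power_prod (insert s (S - {s})) (Poly_Mapping.lookup (frag_of s))"
        using s by (simp add: h_def insert_absorb)
      also have "\<dots> = s"
        using S s power_prod_zero[of "S - {s}" "\<lambda>x. if x = s then 1 else 0"]
        by (subst power_prod_insert) (auto simp: subset_iff)
      finally show "s \<in> h ` carrier ?F"
        using s by (intro image_eqI[of _ _ "frag_of s"]) (simp_all add: frag_of_in_free_Abelian_group)
    qed
  qed
  ultimately have "h \<in> iso ?F G"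
    using hom unfolding iso_def bij_betw_def using h.hom_closed by blast
  then have "G \<cong> ?F" by (intro group.iso_sym[OF group_free_Abelian_group] is_isoI)
  then show ?thesis unfolding is_free_abelian_group_def by blast
qed

lemma torsion_free_pow_eq_one:
  assumes "torsion_free_group G" "x \<in> carrier G" "x [^] (k :: int) = \<one>" "k \<noteq> 0"
  shows "x = \<one>"
  using assms int_pow_eq_id[of x k] unfolding torsion_free_group_def by auto

text \<open>Take a generating set of least cardinality and, over all such sets, a relation of least height.  If two exponents are nonzero, then \<open>x\<^sup>a y\<^sup>b = x\<^bsup>a \<mp> b\<^esup> (y x\<^bsup>\<plusminus>1\<^esup>)\<^sup>b\<close> lowers the height.\<close>

lemma torsion_free_imp_is_free_abelian_group:
  assumes fg: "finitely_generated_group G" and tf: "torsion_free_group G"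
  shows "is_free_abelian_group G"
proof -
  define gens where "gens S \<longleftrightarrow> finite S \<and> S \<subseteq> carrier G \<and> generate G S = carrier G" for S
  have "\<exists>S. gens S" using fg by (simp add: gens_def finitely_generated_group_def)
  then obtain S0 where S0: "gens S0" and min: "\<And>S. gens S \<Longrightarrow> card S0 \<le> card S"
    using ex_has_least_nat[of gens _ card] by blast
  have gensI: "gens T" if "gens S" "finite T" "T \<subseteq> carrier G" "S \<subseteq> generate G T" for S T
  proof -
    have "carrier G \<subseteq> generate G T"
      using generate_subgroup_incl[OF that(4) generate_is_subgroup[OF that(3)]] that(1)
      by (simp add: gens_def)
    then show ?thesis using that(2,3) generate_incl[OF that(3)] by (auto simp: gens_def)
  qed
  show ?thesis
  proof (rule ccontr)
    assume not_free: "\<not> is_free_abelian_group G"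
    define bad where "bad = (\<lambda>(S, m). gens S \<and> card S = card S0 \<and> power_prod S m = \<one> \<and> (\<exists>s\<in>S. m s \<noteq> 0))"
    define height :: "'a set \<times> ('a \<Rightarrow> int) \<Rightarrow> nat"
      where "height = (\<lambda>(S, m). \<Sum>s\<in>S. nat \<bar>m s\<bar>)"
    have "\<exists>Sm. bad Sm"
      using not_free is_free_abelian_groupI[of S0] S0 by (auto simp: bad_def gens_def)
    then obtain Sm where "bad Sm" and "\<And>Tn. bad Tn \<Longrightarrow> height Sm \<le> height Tn"
      using ex_has_least_nat[of bad _ height] by blast
    moreover obtain S m where "Sm = (S, m)" by force
    ultimately have S: "gens S" "card S = card S0" "power_prod S m = \<one>" "\<exists>s\<in>S. m s \<noteq> 0"
      and least: "\<And>T n. bad (T, n) \<Longrightarrow> (\<Sum>s\<in>S. nat \<bar>m s\<bar>) \<le> (\<Sum>s\<in>T. nat \<bar>n s\<bar>)"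
      by (auto simp: bad_def height_def)
    have fin: "finite S" and sub: "S \<subseteq> carrier G" using S(1) by (auto simp: gens_def)
    have reduce: False if xy: "x \<in> S" "y \<in> S" "x \<noteq> y" and m: "m y \<noteq> 0" "\<bar>m y\<bar> \<le> \<bar>m x\<bar>" for x y
    proof -
      \<comment> \<open>The sign for which \<open>\<bar>m x - \<epsilon> * m y\<bar> = \<bar>m
        x\<bar> - \<bar>m y\<bar>\<close>.\<close>
      define \<epsilon> where "\<epsilon> = sgn (m x) * sgn (m y)"
      define y' where "y' = y \<otimes> x [^] \<epsilon>"
      define T where "T = S - {x, y}"
      have S_eq: "S = insert x (insert y T)" "x \<notin> insert y T" "y \<notin> T" "finite T" "T \<subseteq> carrier G"
        using xy fin sub by (auto simp: T_def)
      have xy_carrier: "x \<in> carrier G" "y \<in> carrier G" "y' \<in> carrier G"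
        using xy sub by (auto simp: y'_def)
      have "gens (insert x (insert y' T))"
      proof (rule gensI[OF S(1)])
        let ?H = "generate G (insert x (insert y' T))"
        have H: "subgroup ?H G" using S_eq xy_carrier by (intro generate_is_subgroup) auto
        have "x \<in> ?H" "y' \<in> ?H" "T \<subseteq> ?H" by (auto intro: generate.incl)
        moreover from this have "y' \<otimes> inv (x [^] \<epsilon>) \<in> ?H"
          using H by (intro subgroup.m_closed[OF H] subgroup.m_inv_closed[OF H] subgroup_int_pow_closed)
        moreover have "y' \<otimes> inv (x [^] \<epsilon>) = y" using xy_carrier by (simp add: y'_def m_assoc)
        ultimately show "S \<subseteq> ?H" using S_eq by auto
      qed (use S_eq xy_carrier in auto)
      then have gens: "gens (insert x (insert y' T))" .
      \<comment> \<open>A coincidence would leave a generating set below the least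
        cardinality.\<close>
      have y': "y' \<notin> insert x T"
      proof
        assume "y' \<in> insert x T"
        then have "insert x (insert y' T) = insert x T" by auto
        then have "card S0 \<le> card (insert x T)" using min[OF gens] by simp
        also have "\<dots> < card S" using S_eq by simp
        finally show False using S(2) by simp
      qed
      then have x_notin: "x \<notin> insert y' T" "y' \<notin> T" using S_eq(2) by auto
      define n where "n = m(y' := m y, x := m x - \<epsilon> * m y)"
      have n: "n y' = m y" "n x = m x - \<epsilon> * m y" "\<And>s. s \<in> T \<Longrightarrow> n s = m s"
        using y' S_eq(2) by (auto simp: n_def)
      have "power_prod (insert x (insert y' T)) n = x [^] n x \<otimes> (y' [^] n y' \<otimes> power_prod T n)"
        using y' S_eq xy_carrier by (subst power_prod_insert; (subst power_prod_insert)?) auto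
      also have "power_prod T n = power_prod T m" using n S_eq by (intro power_prod_cong) auto
      also have "x [^] n x \<otimes> (y' [^] n y' \<otimes> power_prod T m) = x [^] m x \<otimes> (y [^] m y \<otimes> power_prod T m)"
      proof -
        have "y' [^] m y = y [^] m y \<otimes> x [^] (\<epsilon> * m y)"
          using xy_carrier by (simp add: y'_def int_pow_distrib int_pow_pow)
        moreover have "x [^] (m x - \<epsilon> * m y) \<otimes> x [^] (\<epsilon> * m y) = x [^] m x"
          using xy_carrier by (simp flip: int_pow_mult)
        moreover have "x [^] (m x - \<epsilon> * m y) \<otimes> (y [^] m y \<otimes> x [^] (\<epsilon> * m y) \<otimes> power_prod T m)
          = (x [^] (m x - \<epsilon> * m y) \<otimes> x [^] (\<epsilon> * m y)) \<otimes> (y [^] m y \<otimes> power_prod T m)"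
          using xy_carrier power_prod_closed[OF S_eq(5)] by (simp add: m_ac)
        ultimately show ?thesis by (simp add: n)
      qed
      also have "\<dots> = power_prod S m"
        unfolding S_eq(1) using S_eq xy_carrier
        by (subst power_prod_insert; (subst power_prod_insert)?) auto
      finally have "power_prod (insert x (insert y' T)) n = \<one>" using S(3) by simp
      moreover have "card (insert x (insert y' T)) = card S0"
        using S(2) x_notin S_eq by simp
      moreover have "n y' \<noteq> 0" using n m by simp
      ultimately have "bad (insert x (insert y' T), n)" using gens by (auto simp: bad_def)
      from least[OF this]
      have "nat \<bar>m x\<bar> + nat \<bar>m y\<bar> \<le> nat \<bar>m x - \<epsilon> * m y\<bar> + nat \<bar>m y\<bar>"
        using x_notin S_eq n by simp
      moreover have "\<bar>m x - \<epsilon> * m y\<bar> < \<bar>m x\<bar>"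
        using m by (auto simp: \<epsilon>_def sgn_if)
      ultimately show False by linarith
    qed
    obtain x where x: "x \<in> S" "m x \<noteq> 0" using S(4) by blast
    have "m y = 0" if "y \<in> S" "y \<noteq> x" for y
      using reduce[of x y] reduce[of y x] that x by fastforce
    then have "power_prod (S - {x}) m = \<one>" using sub by (intro power_prod_zero) auto
    moreover have "power_prod (insert x (S - {x})) m = x [^] m x \<otimes> power_prod (S - {x}) m"
      using fin sub x by (intro power_prod_insert) auto
    ultimately have "x [^] m x = \<one>" using S(3) x sub by (auto simp: insert_absorb)
    then have "x = \<one>" using torsion_free_pow_eq_one[OF tf] x sub by blast
    have "gens (S - {x})"
    proof (rule gensI[OF S(1)])
      show "S \<subseteq> generate G (S - {x})"
        using \<open>x = \<one>\<close> by (auto intro: generate.incl generate.one)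
    qed (use fin sub in auto)
    then have "card S \<le> card (S - {x})" using min S(2) by simp
    then show False using x(1) fin by (metis card_Diff1_less not_le)
  qed
qed

end

section \<open>Zeros of polynomials in two variables\<close>

text \<open>\<open>c\<close> is the outer variable: \<open>degree\<close>, \<open>lead_coeff\<close>
  and pseudo-division refer to it, over coefficients that are polynomials in
  \<open>z\<close>.\<close>

definition eval2 :: "complex poly poly \<Rightarrow> complex \<Rightarrow> complex \<Rightarrow> complex" where
  "eval2 p z c = poly (poly p [:c:]) z"

lemma eval2_simps [simp]:
  "eval2 (p + q) z c = eval2 p z c + eval2 q z c"
  "eval2 (p * q) z c = eval2 p z c * eval2 q z c"
  "eval2 (smult r p) z c = poly r z * eval2 p z c"
  "eval2 [:r:] z c = poly r z" "eval2 (pCons r p) z c = poly r z + c * eval2 p z c"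
  "eval2 0 z c = 0"
  by (simp_all add: eval2_def)

lemma eval2_map_poly: "eval2 p z c = poly (map_poly (\<lambda>r. poly r z) p) c"
  by (induction p) (simp_all add: map_poly_pCons)

lemma infinite_norm_gt_1: "infinite {z :: complex. norm z > 1}"
proof -
  have "range (\<lambda>n. of_nat (n + 2)) \<subseteq> {z :: complex. norm z > 1}"
  proof clarify
    fix n
    have "norm (of_nat (n + 2) :: complex) = real (n + 2)" by (rule norm_of_nat)
    then show "norm (of_nat (n + 2) :: complex) > 1" by linarith
  qed
  moreover have "infinite (range (\<lambda>n. of_nat (n + 2) :: complex))"
    by (intro range_inj_infinite injI) simp
  ultimately show ?thesis using finite_subset by blast
qed

lemma infinite_vanishing_imp_zero:
  assumes "infinite S" "\<And>z. z \<in> S \<Longrightarrow> poly p z = 0"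
  shows "p = (0 :: complex poly)"
  using assms poly_roots_finite[of p] by (metis (mono_tags) finite_subset mem_Collect_eq subsetI)

text \<open>Among the nonzero polynomials that vanish on a part of \<open>Y\<close> with infinitely many first
  coordinates, choose \<open>P\<close> of least degree in the second variable.  By pseudo-division every
  polynomial that vanishes on \<open>Y\<close> vanishes at all zeros of \<open>P\<close> over points where the leading
  coefficient of \<open>P\<close> does not vanish.\<close>

lemma plane_curve_large_point:
  assumes inf: "infinite (fst ` Y)" and Y: "\<And>z c. (z, c) \<in> Y \<Longrightarrow> c \<noteq> 0 \<and> c \<noteq> 1"
  obtains z c where "norm z > 1" "c \<noteq> 0" "c \<noteq> 1"
    "\<And>p. (\<And>z c. (z, c) \<in> Y \<Longrightarrow> eval2 p z c = 0) \<Longrightarrow> eval2 p z c = 0"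
proof -
  define good where "good p \<longleftrightarrow> p \<noteq> 0 \<and>
    (\<exists>Z\<subseteq>Y. infinite (fst ` Z) \<and> (\<forall>(z, c)\<in>Z. eval2 p z c = 0))" for p
  show ?thesis
  proof (cases "\<exists>p. good p")
    case False
    \<comment> \<open>Here only the zero polynomial vanishes on \<open>Y\<close>, so any admissible
      point will do.\<close>
    then have zero: "p = 0" if "\<And>z c. (z, c) \<in> Y \<Longrightarrow> eval2 p z c = 0" for p
      using inf that unfolding good_def by blast
    show ?thesis
    proof (rule that[of 2 2])
      show "eval2 p 2 2 = 0" if "\<And>z c. (z, c) \<in> Y \<Longrightarrow> eval2 p z c = 0" for p
        using zero[OF that] by simp
    qed simp_all
  next
    case True
    then obtain P where P: "good P" and min: "\<And>p. good p \<Longrightarrow> degree P \<le> degree p"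
      using ex_has_least_nat[of good _ degree] by blast
    then obtain Z where Z: "Z \<subseteq> Y" "infinite (fst ` Z)" "\<And>z c. (z, c) \<in> Z \<Longrightarrow> eval2 P z c = 0"
      and "P \<noteq> 0" unfolding good_def by blast
    have Z_zero: "r = 0" if "\<And>z c. (z, c) \<in> Z \<Longrightarrow> poly r z = 0" for r
      using Z(2) that by (intro infinite_vanishing_imp_zero[of "fst ` Z"]) auto
    have lc: "lead_coeff P \<noteq> 0" using \<open>P \<noteq> 0\<close> by simp
    \<comment> \<open>The factor c - a has no zero on \<open>Y\<close>, so it could be divided out,
      leaving a good polynomial of smaller degree.\<close>
    have at: "poly P [:a:] \<noteq> 0" if "a = 0 \<or> a = 1" for a
    proof
      assume "poly P [:a:] = 0"
      then obtain Q where Q: "P = [:- [:a:], 1:] * Q" unfolding poly_eq_0_iff_dvd by blast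
      then have "Q \<noteq> 0" using \<open>P \<noteq> 0\<close> by auto
      then have "degree P = Suc (degree Q)" unfolding Q by (subst degree_mult_eq) auto
      moreover have "eval2 Q z c = 0" if "(z, c) \<in> Z" for z c
      proof -
        have "(c - a) * eval2 Q z c = 0"
          using Z(3)[OF that] by (simp add: Q algebra_simps)
        moreover have "c \<noteq> a" using \<open>a = 0 \<or> a = 1\<close> Y[of z c] that Z(1) by blast
        ultimately show ?thesis by simp
      qed
      then have "good Q" using \<open>Q \<noteq> 0\<close> Z unfolding good_def by blast
      ultimately show False using min[of Q] by simp
    qed
    have "degree P > 0"
    proof (rule ccontr)
      assume "\<not> degree P > 0"
      then obtain r where "P = [:r:]" by (metis degree_eq_zeroE gr0I)
      then show False using Z_zero[of r] Z(3) \<open>P \<noteq> 0\<close> by auto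
    qed
    \<comment> \<open>Off the zeros of \<open>r\<close> the degree in \<open>c\<close> survives
      specialization at \<open>z\<close>, so a root exists, and it is neither 0 nor 1.\<close>
    define r where "r = lead_coeff P * poly P [:0:] * poly P [:1:]"
    have "r \<noteq> 0" using lc at[of 0] at[of 1] by (simp add: r_def)
    then obtain z where "norm z > 1" "poly r z \<noteq> 0"
      using infinite_vanishing_imp_zero[OF infinite_norm_gt_1] by blast
    then have z: "norm z > 1" "poly (lead_coeff P) z \<noteq> 0" "eval2 P z 0 \<noteq> 0" "eval2 P z 1 \<noteq> 0"
      by (auto simp: r_def eval2_def)
    have "degree P \<le> degree (map_poly (\<lambda>r. poly r z) P)"
      using z(2) by (intro le_degree) (simp add: coeff_map_poly)
    then have "degree (map_poly (\<lambda>r. poly r z) P) > 0" using \<open>degree P > 0\<close> by linarith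
    then obtain c where c: "eval2 P z c = 0"
      using alg_closed_imp_poly_has_root unfolding eval2_map_poly by blast
    have "eval2 p z c = 0" if p: "\<And>z c. (z, c) \<in> Y \<Longrightarrow> eval2 p z c = 0" for p
    proof -
      obtain q s where qs: "pseudo_divmod p P = (q, s)" by fastforce
      define k where "k = Suc (degree p) - degree P"
      have div: "smult (lead_coeff P ^ k) p = P * q + s" "s = 0 \<or> degree s < degree P"
        using pseudo_divmod[OF \<open>P \<noteq> 0\<close> qs] by (simp_all add: k_def)
      have "eval2 s z c = 0" if "(z, c) \<in> Z" for z c
        using arg_cong[OF div(1), of "\<lambda>p. eval2 p z c"] that Z(1,3) p by auto
      \<comment> \<open>A nonzero remainder would be a good polynomial of degree below that of
        \<open>P\<close>.\<close>
      then have "good s" if "s \<noteq> 0" using that Z(1,2) unfolding good_def by blast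
      then have "s = 0" using div(2) min[of s] by linarith
      then have "poly (lead_coeff P ^ k) z * eval2 p z c = 0"
        using arg_cong[OF div(1), of "\<lambda>p. eval2 p z c"] c by simp
      then show ?thesis using z(2) by simp
    qed
    moreover have "c \<noteq> 0" "c \<noteq> 1" using c z by auto
    ultimately show ?thesis using that z(1) by blast
  qed
qed

section \<open>Laurent polynomials\<close>

text \<open>Polynomials in \<open>z\<close>, 1 / z and \<open>c\<close>, described by clearing
  denominators. The point \<open>z = 0\<close>, where division takes its default value, is left
  out.\<close>

definition laurent_functions :: "(complex \<Rightarrow> complex \<Rightarrow> complex) set" where
  "laurent_functions = {f. \<exists>p k. \<forall>z c. z \<noteq> 0 \<longrightarrow> z ^ k * f z c = eval2 p z c}"

lemma laurent_functionsI:
  "(\<And>z c. z \<noteq> 0 \<Longrightarrow> z ^ k * f z c = eval2 p z c) \<Longrightarrow> f \<in> laurent_functions"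
  unfolding laurent_functions_def by blast

lemma laurent_functions_add:
  assumes "f \<in> laurent_functions" "g \<in> laurent_functions"
  shows "(\<lambda>z c. f z c + g z c) \<in> laurent_functions"
proof -
  obtain p k q l where "\<And>z c. z \<noteq> 0 \<Longrightarrow> z ^ k * f z c = eval2 p z c"
    "\<And>z c. z \<noteq> 0 \<Longrightarrow> z ^ l * g z c = eval2 q z c"
    using assms unfolding laurent_functions_def by blast
  note * = this[symmetric]
  show ?thesis
    by (rule laurent_functionsI[of "k + l" _ "smult (monom 1 l) p + smult (monom 1 k) q"])
      (simp add: * poly_monom power_add algebra_simps)
qed

lemma laurent_functions_mult:
  assumes "f \<in> laurent_functions" "g \<in> laurent_functions"
  shows "(\<lambda>z c. f z c * g z c) \<in> laurent_functions"
proof -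
  obtain p k q l where "\<And>z c. z \<noteq> 0 \<Longrightarrow> z ^ k * f z c = eval2 p z c"
    "\<And>z c. z \<noteq> 0 \<Longrightarrow> z ^ l * g z c = eval2 q z c"
    using assms unfolding laurent_functions_def by blast
  note * = this[symmetric]
  show ?thesis
    by (rule laurent_functionsI[of "k + l" _ "p * q"])
      (simp add: * poly_monom power_add algebra_simps)
qed

lemma laurent_functions_const: "(\<lambda>z c. a) \<in> laurent_functions"
  by (rule laurent_functionsI[of 0 _ "[:[:a:]:]"]) simp

lemma laurent_functions_fst: "(\<lambda>z c. z ^ n) \<in> laurent_functions"
  by (rule laurent_functionsI[of 0 _ "[:monom 1 n:]"]) (simp add: poly_monom)

lemma laurent_functions_inverse: "(\<lambda>z c. 1 / z ^ n) \<in> laurent_functions"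
  by (rule laurent_functionsI[of n _ "[:1:]"]) simp

lemma laurent_functions_snd: "(\<lambda>z c. c) \<in> laurent_functions"
  by (rule laurent_functionsI[of 0 _ "[:0, 1:]"]) simp

lemma laurent_functions_diff:
  assumes "f \<in> laurent_functions" "g \<in> laurent_functions"
  shows "(\<lambda>z c. f z c - g z c) \<in> laurent_functions"
  using laurent_functions_add[OF assms(1) laurent_functions_mult[OF laurent_functions_const[of "-1"] assms(2)]]
  by simp

lemmas laurent_functions_intros = laurent_functions_add laurent_functions_mult laurent_functions_diff
  laurent_functions_const laurent_functions_fst laurent_functions_inverse laurent_functions_snd

section \<open>The special linear groups\<close>

lemma polynomial_functions_sum:
  "finite I \<Longrightarrow> (\<And>i. i \<in> I \<Longrightarrow> f i \<in> polynomial_functions n) \<Longrightarrow>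
    (\<lambda>A. \<Sum>i\<in>I. f i A) \<in> polynomial_functions n"
  by (induction I rule: finite_induct) (auto intro: polynomial_functions.intros)

lemma polynomial_functions_prod:
  "finite I \<Longrightarrow> (\<And>i. i \<in> I \<Longrightarrow> f i \<in> polynomial_functions n) \<Longrightarrow>
    (\<lambda>A. \<Prod>i\<in>I. f i A) \<in> polynomial_functions n"
  by (induction I rule: finite_induct) (auto intro: polynomial_functions.intros)

lemma polynomial_functions_diff:
  assumes "f \<in> polynomial_functions n" "g \<in> polynomial_functions n"
  shows "(\<lambda>A. f A - g A) \<in> polynomial_functions n"
proof -
  have "(\<lambda>A. f A + (-1) * g A) \<in> polynomial_functions n"
    using assms by (intro polynomial_functions.intros)
  then show ?thesis by simp
qed

text \<open>Leibniz's formula. The shift by 1 tests for the eigenvalue 1, the shift by 0 gives the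
  determinant.\<close>

lemma polynomial_function_det_shift:
  "\<exists>f\<in>polynomial_functions n. \<forall>A\<in>carrier_mat n n. f A = det (A - c \<cdot>\<^sub>m 1\<^sub>m n)"
proof -
  let ?f = "\<lambda>A. \<Sum>p \<in> {p. p permutes {0 ..< n}}.
     signof p * (\<Prod>i = 0 ..< n. A $$ (i, p i) - c * 1\<^sub>m n $$ (i, p i))"
  have less: "p i < n" if "p permutes {0..<n}" "i < n" for p i
    using permutes_in_image[of p "{0..<n}" i] that by simp
  have "?f \<in> polynomial_functions n"
  proof (intro polynomial_functions_sum polynomial_functions.mult[OF polynomial_functions.const]
      polynomial_functions_prod)
    fix p i assume "p \<in> {p. p permutes {0 ..< n}}" "i \<in> {0..<n}"
    then show "(\<lambda>A. A $$ (i, p i) - c * 1\<^sub>m n $$ (i, p i)) \<in> polynomial_functions n"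
      using less by (intro polynomial_functions_diff polynomial_functions.const) (simp add: polynomial_functions.entry)
  qed (simp_all add: finite_permutations)
  moreover have "?f A = det (A - c \<cdot>\<^sub>m 1\<^sub>m n)" if "A \<in> carrier_mat n n" for A
  proof -
    have "det (A - c \<cdot>\<^sub>m 1\<^sub>m n) = (\<Sum>p \<in> {p. p permutes {0 ..< n}}.
     signof p * (\<Prod>i = 0 ..< n. (A - c \<cdot>\<^sub>m 1\<^sub>m n) $$ (i, p i)))"
      using that by (intro det_def') auto
    also have "\<dots> = ?f A"
      using that by (intro sum.cong[OF refl] arg_cong[where f = "\<lambda>x. signof _ * x"] prod.cong[OF refl])
        (simp add: less)
    finally show ?thesis ..
  qed
  ultimately show ?thesis by (intro bexI[of _ ?f] ballI)
qed

lemma polynomial_function_det: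
  "\<exists>f\<in>polynomial_functions n. \<forall>A\<in>carrier_mat n n. f A = det A"
proof -
  have "A - 0 \<cdot>\<^sub>m 1\<^sub>m n = A" if "A \<in> carrier_mat n n" for A :: "complex mat"
    using that by (intro eq_matI) auto
  then show ?thesis using polynomial_function_det_shift[of n 0] by auto
qed

section \<open>The special linear groups as linear algebraic groups\<close>

definition SL :: "nat \<Rightarrow> complex mat set" where
  "SL n = {A \<in> carrier_mat n n. det A = 1}"

lemma GL_simps [simp]:
  "A \<otimes>\<^bsub>GL n\<^esub> B = A * B" "\<one>\<^bsub>GL n\<^esub> = 1\<^sub>m n"
  by (simp_all add: GL_def units_of_mult units_of_one ring_mat_simps)

lemma carrier_GL: "carrier (GL n) = {A \<in> carrier_mat n n. det A \<noteq> 0}"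
  using det_non_zero_imp_unit[of _ n "()"] unit_imp_det_non_zero[of _ n "()"]

  by (auto simp: GL_def units_of_carrier) (simp add: Units_def ring_mat_simps)

lemma group_GL: "group (GL n)"
proof -
  interpret ring "ring_mat TYPE(complex) n ()" by (rule ring_mat)
  show ?thesis unfolding GL_def by (rule units_group)
qed

lemma SL_subset_GL: "SL n \<subseteq> carrier (GL n)"
  by (auto simp: SL_def carrier_GL)

lemma one_in_SL: "1\<^sub>m n \<in> SL n"
  by (simp add: SL_def)

lemma subgroup_SL: "subgroup (SL n) (GL n)"
proof -
  interpret group "GL n" by (rule group_GL)
  show ?thesis
  proof (rule subgroupI)
    fix A assume A: "A \<in> SL n"
    have "inv\<^bsub>GL n\<^esub> A \<in> carrier (GL n)" "A * inv\<^bsub>GL n\<^esub> A = 1\<^sub>m n"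
      using A SL_subset_GL r_inv[of A] inv_closed by auto
    moreover from this have "det A * det (inv\<^bsub>GL n\<^esub> A) = 1"
      using A det_mult[of A n "inv\<^bsub>GL n\<^esub> A"] by (auto simp: SL_def carrier_GL)
    ultimately show "inv\<^bsub>GL n\<^esub> A \<in> SL n"
      using A by (auto simp: SL_def carrier_GL)
  next
    fix A B assume "A \<in> SL n" "B \<in> SL n"
    then show "A \<otimes>\<^bsub>GL n\<^esub> B \<in> SL n"
      by (auto simp: SL_def det_mult)
  qed (use SL_subset_GL one_in_SL in auto)
qed

lemma closedin_zariski_zeros:
  assumes "f \<in> polynomial_functions n"
  shows "closedin (zariski n) {A \<in> carrier_mat n n. f A = 0}"
  unfolding closedin_zariski zero_locus_def
  using assms by (intro exI[of _ "{f}"]) auto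

lemma closed_subvariety_zeros:
  assumes "f \<in> polynomial_functions n" "G \<subseteq> carrier_mat n n"
  shows "closed_subvariety n G {A \<in> G. f A = 0}"
proof -
  have "{A \<in> G. f A = 0} = {A \<in> carrier_mat n n. f A = 0} \<inter> G" using assms(2) by auto
  then show ?thesis
    unfolding closed_subvariety_def closedin_subtopology
    using closedin_zariski_zeros[OF assms(1)] by blast
qed

lemma linear_algebraic_group_SL: "linear_algebraic_group n (SL n)"
proof -
  obtain f where f: "f \<in> polynomial_functions n" "\<And>A. A \<in> carrier_mat n n \<Longrightarrow> f A = det A"
    using polynomial_function_det by blast
  have "(\<lambda>A. f A - 1) \<in> polynomial_functions n"
    using f(1) by (intro polynomial_functions_diff polynomial_functions.const)
  from closedin_zariski_zeros[OF this]
  have "closedin (zariski n) (SL n)"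
    using f(2) by (auto simp: SL_def cong: conj_cong)
  then have "closedin (subtopology (zariski n) (carrier (GL n))) (SL n)"
    using SL_subset_GL unfolding closedin_subtopology by blast
  then show ?thesis using subgroup_SL by (simp add: linear_algebraic_group_def)
qed

section \<open>Connectedness of the special linear groups\<close>

text \<open>Pulls polynomial functions back to a rational curve: \<open>P\<close> is a common
  denominator of the entries, and sums and products accumulate its powers, whence the exponent
  \<open>k\<close>.\<close>

lemma polynomial_function_along_curve:
  assumes "f \<in> polynomial_functions n"
    and "\<And>i j. i < n \<Longrightarrow> j < n \<Longrightarrow> \<exists>q. \<forall>t\<in>D. M t $$ (i, j) * poly P t = poly q t"
  shows "\<exists>q k. \<forall>t\<in>D. f (M t) * poly P t ^ k = poly q (t :: complex)"
  using assms(1)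
proof (induction f rule: polynomial_functions.induct)
  case (const c)
  have "\<forall>t\<in>D. c * poly P t ^ 0 = poly [:c:] t" by simp
  then show ?case by blast
next
  case (entry i j)
  then obtain q where "\<forall>t\<in>D. M t $$ (i, j) * poly P t = poly q t" using assms(2) by blast
  then have "\<forall>t\<in>D. M t $$ (i, j) * poly P t ^ 1 = poly q t" by simp
  then show ?case by blast
next
  case (add f g)
  then obtain q k r l where "\<forall>t\<in>D. f (M t) * poly P t ^ k = poly q t"
    "\<forall>t\<in>D. g (M t) * poly P t ^ l = poly r t" by blast
  then have "\<forall>t\<in>D. (f (M t) + g (M t)) * poly P t ^ (k + l) = poly (q * P ^ l + r * P ^ k) t"
    by (simp add: power_add distrib_right flip: mult.assoc)
  then show ?case by blast
next
  case (mult f g)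
  then obtain q k r l where "\<forall>t\<in>D. f (M t) * poly P t ^ k = poly q t"
    "\<forall>t\<in>D. g (M t) * poly P t ^ l = poly r t" by blast
  then have "\<forall>t\<in>D. (f (M t) * poly P t ^ k) * (g (M t) * poly P t ^ l) = poly (q * r) t"
    by simp
  then have "\<forall>t\<in>D. (f (M t) * g (M t)) * poly P t ^ (k + l) = poly (q * r) t"
    by (simp only: power_add mult_ac)
  then show ?case by blast
qed

text \<open>Two elements \<open>A\<close> and \<open>B\<close> of \<open>SL n\<close> lie on the rational curve obtained from the line
  through them by dividing the first row by the determinant.\<close>

lemma connectedin_SL:
  assumes "n > 0"
  shows "connectedin (zariski n) (SL n)"
proof -
  have False if E: "closedin (zariski n) E1" "closedin (zariski n) E2" "SL n \<subseteq> E1 \<union> E2"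
    "E1 \<inter> E2 \<inter> SL n = {}" and A: "A \<in> E1 \<inter> SL n" and B: "B \<in> E2 \<inter> SL n" for E1 E2 A B
  proof -
    define L where "L t = A + t \<cdot>\<^sub>m (B - A)" for t
    have AB: "A \<in> carrier_mat n n" "B \<in> carrier_mat n n" "det A = 1" "det B = 1"
      using A B by (auto simp: SL_def)
    then have L: "L t \<in> carrier_mat n n" for t by (auto simp: L_def)
    have L_entry: "L t $$ (i, j) = A $$ (i, j) + t * (B $$ (i, j) - A $$ (i, j))"
      if "i < n" "j < n" for i j t
      using that AB by (simp add: L_def)
    have L_poly: "\<exists>q. \<forall>t. L t $$ (i, j) = poly q t" if "i < n" "j < n" for i j
      by (rule exI[of _ "[:A $$ (i, j), B $$ (i, j) - A $$ (i, j):]"])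
        (use that in \<open>simp add: L_entry\<close>)
    obtain P where P: "\<And>t. det (L t) = poly P t"
    proof -
      obtain f where f: "f \<in> polynomial_functions n" "\<And>A. A \<in> carrier_mat n n \<Longrightarrow> f A = det A"
        using polynomial_function_det by blast
      have "\<exists>q k. \<forall>t\<in>UNIV. f (L t) * poly 1 t ^ k = poly q t"
        by (rule polynomial_function_along_curve[OF f(1)]) (use L_poly in auto)
      then show ?thesis using f(2)[OF L] that by auto
    qed
    have L0: "L 0 = A" "L 1 = B"
      using AB by (auto simp: L_def intro!: eq_matI)
    have P01: "poly P 0 = 1" "poly P 1 = 1"
      using L0 AB by (auto simp flip: P)
    \<comment> \<open>The parameters at which the curve is defined: a cofinite set containing 0 and
      1, the parameters of \<open>A\<close> and \<open>B\<close>.\<close>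
    define D where "D = {t. poly P t \<noteq> 0}"
    have "P \<noteq> 0" "0 \<in> D" "1 \<in> D" using P01 by (auto simp: D_def)
    then have "finite (- D)" using poly_roots_finite[of P] by (simp add: D_def Compl_eq)
    then have infD: "infinite D"
      by (metis Compl_eq_Diff_UNIV finite_Diff2 infinite_UNIV_char_0)
    define M where "M t = multrow 0 (1 / poly P t) (L t)" for t
    have M_entry: "\<exists>q. \<forall>t\<in>D. M t $$ (i, j) * poly P t = poly q t" if ij: "i < n" "j < n" for i j
    proof -
      obtain q where q: "\<forall>t. L t $$ (i, j) = poly q t" using L_poly[OF ij] by blast
      have "M t $$ (i, j) * poly P t = poly (if i = 0 then q else q * P) t" if "t \<in> D" for t
        using that ij L[of t] q by (auto simp: M_def D_def)
      then show ?thesis by blast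
    qed
    have M_SL: "M t \<in> SL n" if "t \<in> D" for t
    proof -
      have "det (M t) = 1 / poly P t * det (L t)"
        unfolding M_def by (rule det_multrow[OF assms L])
      then show ?thesis using that L[of t] by (simp add: P D_def SL_def M_def)
    qed
    have "M 0 = A" "M 1 = B"
      using AB by (auto simp: M_def P01 L0 intro!: eq_matI)
    \<comment> \<open>The numerator of each defining equation has infinitely many zeros, hence
      vanishes. So a closed set with infinitely many points of the curve contains all of it.\<close>
    have all: "\<forall>t\<in>D. M t \<in> E" if E: "closedin (zariski n) E" and inf: "infinite {t\<in>D. M t \<in> E}" for E
    proof -
      obtain F where F: "F \<subseteq> polynomial_functions n" "E = zero_locus n F"
        using E unfolding closedin_zariski by blast
      have "f (M t) = 0" if "f \<in> F" "t \<in> D" for f t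
      proof -
        obtain q k where q: "\<forall>t\<in>D. f (M t) * poly P t ^ k = poly q t"
          using polynomial_function_along_curve[of f n D M P] M_entry F(1) \<open>f \<in> F\<close> by blast
        have "{t\<in>D. M t \<in> E} \<subseteq> {t. poly q t = 0}"
          using q F(2) \<open>f \<in> F\<close> by (auto simp: zero_locus_def) (metis mult_zero_left)
        then have "infinite {t. poly q t = 0}" using inf finite_subset by blast
        then have "q = 0" using poly_roots_finite by blast
        then show ?thesis using q \<open>t \<in> D\<close> by (auto simp: D_def)
      qed
      moreover have "M t \<in> carrier_mat n n" if "t \<in> D" for t
        using M_SL[OF that] by (simp add: SL_def)
      ultimately show ?thesis by (auto simp: F(2) zero_locus_def)
    qed
    have "D \<subseteq> {t\<in>D. M t \<in> E1} \<union> {t\<in>D. M t \<in> E2}" using M_SL E(3) by auto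
    then have "infinite {t\<in>D. M t \<in> E1} \<or> infinite {t\<in>D. M t \<in> E2}"
      using infD by (meson finite_UnI finite_subset)
    \<comment> \<open>Whichever closed set contains infinitely many points of the curve contains
      both ends.\<close>
    then have "B \<in> E1 \<or> A \<in> E2"
      using all[OF E(1)] all[OF E(2)] \<open>M 0 = A\<close> \<open>M 1 = B\<close> \<open>0 \<in> D\<close> \<open>1 \<in> D\<close> by metis
    then show False using A B E(4) by blast
  qed
  then show ?thesis
    unfolding connectedin_closedin topspace_zariski by (auto simp: SL_def)
qed

section \<open>Semisimplicity of the special linear groups\<close>

text \<open>A point is cut out by its matrix entries. The T1 property later reduces a finite
  connected set to a single point.\<close>

lemma t1_space_zariski: "t1_space (zariski n)"
  unfolding t1_space_closedin_singleton topspace_zariski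
proof
  fix B :: "complex mat" assume B: "B \<in> carrier_mat n n"
  let ?F = "{\<lambda>A. A $$ (i, j) - B $$ (i, j) | i j. i < n \<and> j < n}"
  have "?F \<subseteq> polynomial_functions n"
    by (auto intro!: polynomial_functions_diff polynomial_functions.intros)
  moreover have "{B} = zero_locus n ?F"
  proof (intro equalityI subsetI)
    fix A assume "A \<in> zero_locus n ?F"
    then have "A \<in> carrier_mat n n" "\<And>i j. i < n \<Longrightarrow> j < n \<Longrightarrow> A $$ (i, j) - B $$ (i, j) = 0"
      unfolding zero_locus_def by fast+
    then show "A \<in> {B}" using B by (auto intro!: eq_matI)
  qed (use B in \<open>auto simp: zero_locus_def\<close>)
  ultimately show "closedin (zariski n) {B}" unfolding closedin_zariski by blast
qed

definition scalar_matrices :: "nat \<Rightarrow> complex mat set" where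
  "scalar_matrices n = {c \<cdot>\<^sub>m 1\<^sub>m n | c. True}"

lemma quadratic_infinite_zeros:
  assumes "infinite {t :: complex. a + b * t + c * t\<^sup>2 = 0}"
  shows "c = 0"
proof -
  have "infinite {t. poly [:a, b, c:] t = 0}"
    using assms by (simp add: power2_eq_square algebra_simps)
  then have "[:a, b, c:] = 0" using poly_roots_finite by blast
  then show ?thesis by simp
qed

text \<open>\<open>A\<close> commutes up to a root of unity with its conjugates by the transvections \<open>1 + t E\<^sub>i\<^sub>j\<close>.
  For infinitely many \<open>t\<close> this root of unity is the same, and the coefficient of \<open>t\<^sup>2\<close> in the
  entry \<open>(j, j)\<close> of the resulting equation is minus the square of the entry \<open>(j, i)\<close> of \<open>A\<close>.\<close>

lemma normal_central_commutators_imp_scalar: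
  assumes N: "N \<lhd> (GL n)\<lparr>carrier := SL n\<rparr>"
    and comm: "derived ((GL n)\<lparr>carrier := SL n\<rparr>) N \<subseteq> scalar_matrices n"
    and "A \<in> N"
  shows "A \<in> scalar_matrices n"
proof (cases "n = 0")
  case True
  then show ?thesis
    using normal_imp_subgroup[OF N, THEN subgroup.subset] \<open>A \<in> N\<close>
    by (auto simp: SL_def scalar_matrices_def intro!: exI[of _ 0] eq_matI)
next
  case False
  define S where "S = (GL n)\<lparr>carrier := SL n\<rparr>"
  have S_simps [simp]: "carrier S = SL n" "A \<otimes>\<^bsub>S\<^esub> B = A * B" "\<one>\<^bsub>S\<^esub> = 1\<^sub>m n" for A B
    by (simp_all add: S_def)
  interpret S: group S
    unfolding S_def by (rule subgroup.subgroup_is_group[OF subgroup_SL group_GL])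
  interpret N: normal N S using N by (simp add: S_def)
  have N_carrier: "B \<in> carrier_mat n n" "det B = 1" if "B \<in> N" for B
    using N.subset that by (auto simp: SL_def)
  \<comment> \<open>The commutator is a scalar \<zeta>; the determinants of the two products agree,
    which makes \<zeta> a root of unity.\<close>
  have comm: "\<exists>\<zeta>. \<zeta> ^ n = 1 \<and> A * B = \<zeta> \<cdot>\<^sub>m (B * A)" if "A \<in> N" "B \<in> N" for A B
  proof -
    have AB: "A \<in> carrier S" "B \<in> carrier S" using that N.subset by auto
    have "A \<otimes>\<^bsub>S\<^esub> B \<otimes>\<^bsub>S\<^esub> inv\<^bsub>S\<^esub> A \<otimes>\<^bsub>S\<^esub> inv\<^bsub>S\<^esub> B \<in> derived S N"
      unfolding derived_def using that by (intro generate.incl) blast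
    then obtain \<zeta> where \<zeta>: "A \<otimes>\<^bsub>S\<^esub> B \<otimes>\<^bsub>S\<^esub> inv\<^bsub>S\<^esub> A \<otimes>\<^bsub>S\<^esub> inv\<^bsub>S\<^esub> B = \<zeta> \<cdot>\<^sub>m 1\<^sub>m n"
      using comm by (auto simp: scalar_matrices_def S_def)
    have "A * B = (A \<otimes>\<^bsub>S\<^esub> B \<otimes>\<^bsub>S\<^esub> inv\<^bsub>S\<^esub> A \<otimes>\<^bsub>S\<^esub> inv\<^bsub>S\<^esub> B) \<otimes>\<^bsub>S\<^esub> (B \<otimes>\<^bsub>S\<^esub> A)"
    proof -
      have "(A \<otimes>\<^bsub>S\<^esub> B \<otimes>\<^bsub>S\<^esub> inv\<^bsub>S\<^esub> A \<otimes>\<^bsub>S\<^esub> inv\<^bsub>S\<^esub> B) \<otimes>\<^bsub>S\<^esub> (B \<otimes>\<^bsub>S\<^esub> A)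
        = (A \<otimes>\<^bsub>S\<^esub> B) \<otimes>\<^bsub>S\<^esub> (inv\<^bsub>S\<^esub> A \<otimes>\<^bsub>S\<^esub> ((inv\<^bsub>S\<^esub> B \<otimes>\<^bsub>S\<^esub> B) \<otimes>\<^bsub>S\<^esub> A))"
        using AB by (simp only: S.m_assoc S.m_closed S.inv_closed)
      also have "\<dots> = A \<otimes>\<^bsub>S\<^esub> B" using AB by (simp del: S_simps)
      finally show ?thesis by simp
    qed
    then have eq: "A * B = \<zeta> \<cdot>\<^sub>m (B * A)"
      using AB unfolding \<zeta> by (auto simp: SL_def)
    have "det (A * B) = \<zeta> ^ n * det (B * A)"
      using AB unfolding eq by (auto simp: SL_def)
    then have "\<zeta> ^ n = 1"
      using AB det_mult[of A n B] det_mult[of B n A] by (auto simp: SL_def)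
    with eq show ?thesis by blast
  qed
  \<comment> \<open>The conjugate of \<open>A\<close> by the transvection 1 + t E_ij, written as a
    row operation followed by the inverse column operation.\<close>
  define C where "C A i j t = addcol (- t) j i (addrow t i j A)" for A :: "complex mat" and i j t
  have C_N: "C A i j t \<in> N" if "A \<in> N" "i < n" "j < n" "i \<noteq> j" for A i j t
  proof -
    let ?T = "\<lambda>t. addrow_mat n t i j"
    have T: "?T t \<in> SL n" for t using that by (simp add: SL_def det_addrow_mat)
    have "?T (- t) * ?T t = 1\<^sub>m n" using addrow_mat_inv[of i n j "- t"] that by simp
    then have "inv\<^bsub>S\<^esub> (?T t) = ?T (- t)" using T by (intro S.inv_equality) auto
    then have "?T t * A * ?T (- t) \<in> N" using N.inv_op_closed2[of "?T t" A] T that by simp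
    moreover have "addrow t i j A = ?T t * A"
      using that N_carrier(1)[OF \<open>A \<in> N\<close>] by (intro addrow_mat[of _ n n]) simp_all
    moreover have "addcol (- t) j i (?T t * A) = ?T t * A * ?T (- t)"
      using that N_carrier(1)[OF \<open>A \<in> N\<close>]
      by (intro addcol_mat[of _ n n] mult_carrier_mat[of _ n n]) simp_all
    ultimately show ?thesis by (simp add: C_def)
  qed
  have C_index: "C A i j t $$ (k, l) =
      (if l = j then - t * ((if k = i then t * A $$ (j, i) else 0) + A $$ (k, i)) else 0) +
      ((if k = i then t * A $$ (j, l) else 0) + A $$ (k, l))"
    if "A \<in> carrier_mat n n" "i < n" "j < n" "k < n" "l < n" for A i j t k l
    using that by (auto simp: C_def)
  have diag: "A $$ (j, i) = 0" if A: "A \<in> N" and ij: "i < n" "j < n" "i \<noteq> j" for A i j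
  proof -
    have A': "A \<in> carrier_mat n n" using N_carrier A by blast
    have Ct: "C A i j t \<in> carrier_mat n n" for t using N_carrier(1)[OF C_N[OF A ij]] .
    have "\<forall>t\<in>UNIV. \<exists>\<zeta>\<in>{\<zeta>. \<zeta> ^ n = 1}. A * C A i j t = \<zeta> \<cdot>\<^sub>m (C A i j t * A)"
      using comm[OF A C_N[OF A ij]] by blast
    from pigeonhole_infinite_rel[OF _ _ this] obtain \<zeta>
      where inf: "infinite {t. A * C A i j t = \<zeta> \<cdot>\<^sub>m (C A i j t * A)}"
      using finite_roots_unity[of n] False by (auto simp: infinite_UNIV_char_0)
    define \<alpha> where "\<alpha> = (\<Sum>m<n. A $$ (j, m) * A $$ (m, j))"
    define \<beta> where "\<beta> = (\<Sum>m<n. A $$ (j, m) * A $$ (m, i))"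
    have 1: "(A * C A i j t) $$ (j, j)
        = \<alpha> + t * (A $$ (j, i) * A $$ (j, j) - \<beta>) - (A $$ (j, i))\<^sup>2 * t\<^sup>2" for t
    proof -
      have "(A * C A i j t) $$ (j, j) = (\<Sum>m<n. A $$ (j, m) * C A i j t $$ (m, j))"
        using A' Ct[of t] ij by (simp add: scalar_prod_def lessThan_atLeast0)
      also have "\<dots> = (\<Sum>m<n. A $$ (j, m) * A $$ (m, j) - t * (A $$ (j, m) * A $$ (m, i))
          + (if m = i then A $$ (j, i) * t * A $$ (j, j) - (A $$ (j, i))\<^sup>2 * t\<^sup>2 else 0))"
        using A' ij by (intro sum.cong) (auto simp: C_index power2_eq_square algebra_simps)
      also have "\<dots> = \<alpha> - t * \<beta> + (A $$ (j, i) * t * A $$ (j, j) - (A $$ (j, i))\<^sup>2 * t\<^sup>2)"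
        using ij by (simp add: sum.distrib sum_subtractf \<alpha>_def \<beta>_def sum_distrib_left)
      finally show ?thesis by (simp add: algebra_simps)
    qed
    have 2: "(C A i j t * A) $$ (j, j) = \<alpha> - t * (A $$ (j, i) * A $$ (j, j))" for t
    proof -
      have "(C A i j t * A) $$ (j, j) = (\<Sum>m<n. C A i j t $$ (j, m) * A $$ (m, j))"
        using A' Ct[of t] ij by (simp add: scalar_prod_def lessThan_atLeast0)
      also have "\<dots> = (\<Sum>m<n. A $$ (j, m) * A $$ (m, j)
          - (if m = j then t * (A $$ (j, i) * A $$ (j, j)) else 0))"
        using A' ij by (intro sum.cong) (auto simp: C_index power2_eq_square algebra_simps)
      also have "\<dots> = \<alpha> - t * (A $$ (j, i) * A $$ (j, j))"
        using ij by (simp add: sum_subtractf \<alpha>_def)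
      finally show ?thesis .
    qed
    have "(A * C A i j t) $$ (j, j) = \<zeta> * (C A i j t * A) $$ (j, j)"
      if "A * C A i j t = \<zeta> \<cdot>\<^sub>m (C A i j t * A)" for t
      using that A' Ct[of t] ij by auto
    then have "{t. A * C A i j t = \<zeta> \<cdot>\<^sub>m (C A i j t * A)} \<subseteq> {t. (\<alpha> - \<zeta> * \<alpha>)
        + (A $$ (j, i) * A $$ (j, j) - \<beta> + \<zeta> * (A $$ (j, i) * A $$ (j, j))) * t
        + (- (A $$ (j, i))\<^sup>2) * t\<^sup>2 = 0}"
      unfolding 1 2 by (auto simp: algebra_simps)
    then have "- (A $$ (j, i))\<^sup>2 = 0"
      using inf by (intro quadratic_infinite_zeros) (rule infinite_super)
    then show ?thesis by simp
  qed
  have A: "A \<in> carrier_mat n n" using N_carrier \<open>A \<in> N\<close> by blast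
  \<comment> \<open>The conjugate of \<open>A\<close> by 1 + E_0i lies in \<open>N\<close>, so it
    has no off-diagonal entries either; its entry (0, i) is the difference of the two diagonal
    entries of \<open>A\<close>.\<close>
  have "A $$ (i, i) = A $$ (0, 0)" if "i < n" for i
  proof (cases "i = 0")
    case False
    then have "C A 0 i 1 $$ (0, i) = 0"
      using \<open>A \<in> N\<close> that \<open>n \<noteq> 0\<close> by (intro diag C_N) auto
    moreover have "A $$ (0, i) = 0" "A $$ (i, 0) = 0"
      using diag[OF \<open>A \<in> N\<close>] that False by auto
    ultimately show ?thesis using A that False \<open>n \<noteq> 0\<close> by (simp add: C_index)
  qed simp
  note eq = this
  have "A = A $$ (0, 0) \<cdot>\<^sub>m 1\<^sub>m n"
  proof (rule eq_matI)
    fix i j assume "i < dim_row (A $$ (0, 0) \<cdot>\<^sub>m 1\<^sub>m n)" "j < dim_col (A $$ (0, 0) \<cdot>\<^sub>m 1\<^sub>m n)"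
    then show "A $$ (i, j) = (A $$ (0, 0) \<cdot>\<^sub>m 1\<^sub>m n) $$ (i, j)"
      using eq[of i] diag[OF \<open>A \<in> N\<close>, of j i] by (cases "i = j") auto
  qed (use A in auto)
  then show ?thesis unfolding scalar_matrices_def by blast
qed

text \<open>From the trivial end of the derived series backwards, each term is normal with scalar
  commutators, hence scalar. So \<open>R\<close> consists of multiples of the identity by n-th roots
  of unity; being finite and connected, it is trivial.\<close>

lemma semisimple_SL: "semisimple n (SL n)"
proof (cases "n = 0")
  case True
  have "SL n = {\<one>\<^bsub>GL n\<^esub>}" using True by (auto simp: SL_def intro!: eq_matI)
  then show ?thesis
    unfolding semisimple_def
  proof (intro allI impI)
    fix R assume R: "R \<lhd> (GL n)\<lparr>carrier := SL n\<rparr>"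
    show "R = {\<one>\<^bsub>GL n\<^esub>}"
      using subgroup.subset[OF normal_imp_subgroup[OF R]]
        subgroup.one_closed[OF normal_imp_subgroup[OF R]] \<open>SL n = {\<one>\<^bsub>GL n\<^esub>}\<close> by auto
  qed
next
  case False
  define S where "S = (GL n)\<lparr>carrier := SL n\<rparr>"
  have S_simps [simp]: "carrier S = SL n" "\<one>\<^bsub>S\<^esub> = 1\<^sub>m n"
    by (simp_all add: S_def)
  interpret S: group S
    unfolding S_def by (rule subgroup.subgroup_is_group[OF subgroup_SL group_GL])
  show ?thesis
    unfolding semisimple_def
  proof (intro allI impI)
    fix R assume R: "R \<lhd> (GL n)\<lparr>carrier := SL n\<rparr>" "connectedin (zariski n) R"
      "solvable ((GL n)\<lparr>carrier := R\<rparr>)"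
    interpret R: normal R S using R(1) by (simp add: S_def)
    have normal: "(derived S ^^ k) R \<lhd> S" for k
      by (induction k) (auto intro: R.normal_axioms S.derived_is_normal)
    have incl: "(derived S ^^ k) R \<subseteq> R" for k
      by (induction k) (auto dest!: S.derived_incl[OF _ R.subgroup_axioms])
    have SR: "S\<lparr>carrier := R\<rparr> = (GL n)\<lparr>carrier := R\<rparr>" by (simp add: S_def)
    \<comment> \<open>Solvability concerns the derived series inside \<open>R\<close>; it agrees
      with the series taken in \<open>S\<close>, whose terms are normal in \<open>S\<close>.\<close>
    have cons: "(derived (S\<lparr>carrier := R\<rparr>) ^^ k) R = (derived S ^^ k) R" for k
      by (induction k) (simp_all add: S.derived_consistent[OF incl R.subgroup_axioms])
    obtain m where "(derived (S\<lparr>carrier := R\<rparr>) ^^ m) R = {\<one>\<^bsub>S\<^esub>}"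
      using group.solvable_iff_trivial_derived_seq[OF S.subgroup_imp_group[OF R.subgroup_axioms]] R(3)
      by (auto simp: SR)
    then have m: "(derived S ^^ m) R = {1\<^sub>m n}" by (simp add: cons)
    have "(derived S ^^ k) R \<subseteq> scalar_matrices n" if "k \<le> m" for k
      using that
    proof (induction rule: inc_induct)
      case base
      have "1\<^sub>m n = 1 \<cdot>\<^sub>m (1\<^sub>m n :: complex mat)" by (auto intro!: eq_matI)
      then show ?case unfolding m scalar_matrices_def by blast
    next
      case (step k)
      then show ?case
        using normal_central_commutators_imp_scalar[OF normal[of k, unfolded S_def]]
        by (auto simp: S_def)
    qed
    from this[of 0] have scalar: "R \<subseteq> scalar_matrices n" by simp
    have "R \<subseteq> (\<lambda>c. c \<cdot>\<^sub>m 1\<^sub>m n) ` {c. c ^ n = 1}"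
    proof
      fix A assume A: "A \<in> R"
      then obtain c where c: "A = c \<cdot>\<^sub>m 1\<^sub>m n" using scalar by (auto simp: scalar_matrices_def)
      moreover have "det A = 1" using A R.subset by (auto simp: SL_def)
      ultimately show "A \<in> (\<lambda>c. c \<cdot>\<^sub>m 1\<^sub>m n) ` {c. c ^ n = 1}" by auto
    qed
    then have fin: "finite R"
      by (rule finite_subset) (use False finite_roots_unity[of n, where 'a = complex] in auto)
    have one: "1\<^sub>m n \<in> R" using R.one_closed by simp
    \<comment> \<open>A connected T1 set with more than one point has no isolated points, whereas a
      finite one has no limit points.\<close>
    have "\<exists>a. R = {a}"
    proof (rule ccontr)
      assume "\<nexists>a. R = {a}"
      then have "R \<subseteq> zariski n derived_set_of R"
        by (rule connectedin_imp_perfect_gen[OF t1_space_zariski R(2)])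
      also have "\<dots> = {}" using fin t1_space_zariski t1_space_derived_set_of_finite by blast
      finally show False using one by blast
    qed
    then show "R = {\<one>\<^bsub>GL n\<^esub>}" using one by auto
  qed
qed

section \<open>Borel's property for the special linear groups\<close>

abbreviation SL_group :: "nat \<Rightarrow> complex mat monoid" where
  "SL_group n \<equiv> (GL n)\<lparr>carrier := SL n\<rparr>"

lemma group_SL: "group (SL_group n)"
  by (rule subgroup.subgroup_is_group[OF subgroup_SL group_GL])

text \<open>The subvariety is the zero set of \<open>f\<close>; \<open>A\<close> shows that it is
  proper, and torsion-freeness gives \<gamma> infinite order.\<close>

lemma borel_propertyD:
  assumes "borel_property \<Gamma>" "torsion_free_group \<Gamma>" "n > 0" "\<gamma> \<in> carrier \<Gamma>" "\<gamma> \<noteq> \<one>\<^bsub>\<Gamma>\<^esub>"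
    and f: "f \<in> polynomial_functions n" and A: "A \<in> SL n" "f A \<noteq> 0"
  shows "\<exists>\<phi>\<in>hom \<Gamma> (SL_group n). f (\<phi> \<gamma>) \<noteq> 0"
proof -
  let ?V = "{A \<in> SL n. f A = 0}"
  have "closed_subvariety n (SL n) ?V"
    by (rule closed_subvariety_zeros[OF f]) (auto simp: SL_def)
  moreover have "?V \<noteq> SL n" using A by auto
  moreover have "group.ord \<Gamma> \<gamma> = 0" using assms by (auto simp: torsion_free_group_def)
  ultimately obtain \<phi> where \<phi>: "\<phi> \<in> hom \<Gamma> (SL_group n)" "\<phi> \<gamma> \<notin> ?V"
    using assms(1,4,5) linear_algebraic_group_SL connectedin_SL[OF \<open>n > 0\<close>] semisimple_SL
    unfolding borel_property_def by blast
  moreover have "\<phi> \<gamma> \<in> SL n" using hom_in_carrier[OF \<phi>(1) assms(4)] by simp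
  ultimately show ?thesis by blast
qed

lemma hom_SL_D:
  assumes "\<phi> \<in> hom \<Gamma> (SL_group n)"
  shows "g \<in> carrier \<Gamma> \<Longrightarrow> \<phi> g \<in> carrier_mat n n" "g \<in> carrier \<Gamma> \<Longrightarrow> det (\<phi> g) = 1"
    "g \<in> carrier \<Gamma> \<Longrightarrow> h \<in> carrier \<Gamma> \<Longrightarrow> \<phi> (g \<otimes>\<^bsub>\<Gamma>\<^esub> h) = \<phi> g * \<phi> h"
  using hom_in_carrier[OF assms, of g] hom_mult[OF assms, of g h] by (auto simp: SL_def)

section \<open>Representations in \<open>SL 3\<close>\<close>

lemma det_diff_commute:
  fixes A :: "'a :: comm_ring_1 mat"
  assumes "A \<in> carrier_mat n n" "B \<in> carrier_mat n n"
  shows "det (B - A) = (-1) ^ n * det (A - B)"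
proof -
  have "B - A = (-1) \<cdot>\<^sub>m (A - B)" using assms by (intro eq_matI) auto
  then show ?thesis using assms by simp
qed

lemma (in group) borel_property_commute_square:
  assumes "borel_property G" "torsion_free_group G"
    and g: "g \<in> carrier G" and s: "s \<in> carrier G" and comm: "g \<otimes> g \<otimes> s = s \<otimes> (g \<otimes> g)"
  shows "g \<otimes> s = s \<otimes> g"
proof (rule ccontr)
  assume "g \<otimes> s \<noteq> s \<otimes> g"
  define t where "t = g \<otimes> s \<otimes> inv g"
  have t: "t \<in> carrier G" using g s by (simp add: t_def)
  have gs: "g \<otimes> s = t \<otimes> g" using g s by (simp add: t_def m_assoc)
  have "g \<otimes> t = g \<otimes> g \<otimes> s \<otimes> inv g" using g s by (simp add: t_def m_assoc)
  also have "\<dots> = s \<otimes> g" using g s by (simp add: comm) (simp add: m_assoc)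
  finally have gt: "g \<otimes> t = s \<otimes> g" .
  define \<gamma> where "\<gamma> = s \<otimes> inv t"
  have \<gamma>: "\<gamma> \<in> carrier G" "\<gamma> \<otimes> t = s" using s t by (simp_all add: \<gamma>_def m_assoc)
  then have "\<gamma> \<noteq> \<one>" using \<open>g \<otimes> s \<noteq> s \<otimes> g\<close> gs t by auto
  \<comment> \<open>On matrices of size 3, \<open>f\<close> vanishes exactly when 1 is an
    eigenvalue.\<close>
  obtain f where f: "f \<in> polynomial_functions 3"
    "\<And>A. A \<in> carrier_mat 3 3 \<Longrightarrow> f A = det (A - 1 \<cdot>\<^sub>m 1\<^sub>m 3)"
    using polynomial_function_det_shift[of 3 1] by blast
  have one: "1 \<cdot>\<^sub>m 1\<^sub>m 3 = (1\<^sub>m 3 :: complex mat)" by (intro eq_matI) auto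
  define D where "D x y = Matrix.mat 3 3 (\<lambda>(i, j). if i = j then if i = 2 then y else x else (0 :: complex))" for x y
  have det_D: "det (D x y) = x * x * y" for x y
    by (subst det_upper_triangular[of _ 3]) (auto simp: D_def diag_mat_def upper_triangular_def numeral_3_eq_3)
  \<comment> \<open>The diagonal matrix with entries 2, 2, 1/4 has determinant 1 and not the
    eigenvalue 1, so the subvariety is proper.\<close>
  have "D 2 (1 / 4) - 1\<^sub>m 3 = D 1 (- 3 / 4)"
    by (intro eq_matI) (auto simp: D_def)
  then have "D 2 (1 / 4) \<in> SL 3" "f (D 2 (1 / 4)) \<noteq> 0"
    using f(2)[of "D 2 (1 / 4)"] by (simp_all add: SL_def det_D one) (simp_all add: D_def)
  from borel_propertyD[OF assms(1,2) _ \<gamma>(1) \<open>\<gamma> \<noteq> \<one>\<close> f(1) this]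
  obtain \<phi> where \<phi>: "\<phi> \<in> hom G (SL_group 3)" "f (\<phi> \<gamma>) \<noteq> 0" by auto
  note \<phi>_mult = hom_SL_D(3)[OF \<phi>(1)]
  note \<phi>_carrier = hom_SL_D(1)[OF \<phi>(1) g] hom_SL_D(1)[OF \<phi>(1) s]
    hom_SL_D(1)[OF \<phi>(1) t] hom_SL_D(1)[OF \<phi>(1) \<gamma>(1)]
  note \<phi>_det = hom_SL_D(2)[OF \<phi>(1)]
  have "\<phi> g * (\<phi> s - \<phi> t) = \<phi> g * \<phi> s - \<phi> g * \<phi> t"
    using \<phi>_carrier by (intro mult_minus_distrib_mat)
  also have "\<dots> = \<phi> t * \<phi> g - \<phi> s * \<phi> g"
    using gs gt \<phi>_mult g s t by metis
  also have "\<dots> = (\<phi> t - \<phi> s) * \<phi> g"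
    using \<phi>_carrier by (intro minus_mult_distrib_mat[symmetric])
  finally have "det (\<phi> g) * det (\<phi> s - \<phi> t) = det (\<phi> t - \<phi> s) * det (\<phi> g)"
    using \<phi>_carrier by (metis det_mult minus_carrier_mat)
  \<comment> \<open>The size 3 is odd, so this determinant equals its own negative.\<close>
  then have "det (\<phi> s - \<phi> t) = 0"
    using \<phi>_carrier \<phi>_det[OF g] by (simp add: det_diff_commute[of "\<phi> s" 3 "\<phi> t"])
  \<comment> \<open>As \<open>\<gamma> \<otimes> t = s\<close>, the difference is \<phi> \<gamma> -
    1 times an invertible matrix, so the singularity passes to \<phi> \<gamma> - 1.\<close>
  moreover have "(\<phi> \<gamma> - 1\<^sub>m 3) * \<phi> t = \<phi> s - \<phi> t"
    using \<phi>_carrier \<phi>_mult[OF \<gamma>(1) t] \<gamma>(2) by (simp add: minus_mult_distrib_mat)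
  then have "det (\<phi> \<gamma> - 1\<^sub>m 3) * det (\<phi> t) = det (\<phi> s - \<phi> t)"
    using \<phi>_carrier det_mult[of "\<phi> \<gamma> - 1\<^sub>m 3" 3 "\<phi> t"] by (simp add: minus_carrier_mat)
  ultimately have "det (\<phi> \<gamma> - 1\<^sub>m 3) = 0" using \<phi>_det[OF t] by simp
  then show False using \<phi>(2) f(2) \<phi>_carrier by (simp add: one)
qed

section \<open>Representations in \<open>SL 2\<close>\<close>

lemma laurent_functions_divide:
  "f \<in> laurent_functions \<Longrightarrow> (\<lambda>z c. f z c / z ^ n) \<in> laurent_functions"
  using laurent_functions_mult[OF _ laurent_functions_inverse[of n], of f] by simp

lemma hyp_letter_laurent:
  assumes "i < 2" "j < 2"
  shows "(\<lambda>z c. hyp_letter x (z ^ n) c l $$ (i, j)) \<in> laurent_functions"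
proof -
  have "i = 0 \<or> i = Suc 0" "j = 0 \<or> j = Suc 0" using assms by auto
  then show ?thesis
    by (cases "fst l = x"; cases "snd l"; elim disjE)
      (auto simp: hyp_letter_def hyp_def hyp_conj_def Let_def
        intro!: laurent_functions_intros laurent_functions_divide)
qed

lemma mat2_mult_index:
  assumes "A \<in> carrier_mat 2 2" "B \<in> carrier_mat 2 2" "i < 2" "j < 2"
  shows "(A * B) $$ (i, j) = A $$ (i, 0) * B $$ (0, j) + A $$ (i, 1) * B $$ (1, j)"
  using assms by (auto simp: scalar_prod_def numeral_2_eq_2)

lemma hyp_word_laurent:
  assumes "i < 2" "j < 2"
  shows "(\<lambda>z c. hyp_word x (z ^ n) c w $$ (i, j)) \<in> laurent_functions"
  using assms
proof (induction w arbitrary: i)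
  case Nil
  then show ?case by (simp add: hyp_word_def laurent_functions_const)
next
  case (Cons l w)
  have "hyp_word x (z ^ n) c (l # w) $$ (i, j) =
      hyp_letter x (z ^ n) c l $$ (i, 0) * hyp_word x (z ^ n) c w $$ (0, j) +
      hyp_letter x (z ^ n) c l $$ (i, 1) * hyp_word x (z ^ n) c w $$ (1, j)" for z c
    using mat2_mult_index[OF hyp_letter_carrier hyp_word_carrier, of i j x "z ^ n" c l x "z ^ n" c w] Cons.prems
    by (simp add: hyp_word_def)
  then show ?case
    using Cons by (auto intro!: laurent_functions_add laurent_functions_mult hyp_letter_laurent)
qed

text \<open>Clearing powers of \<open>z\<close> turns \<open>f\<close> into a polynomial, to which
  \<open>ext\<close> applies. This carries the entries of a word relation from \<open>Y\<close> to
  the point of large norm.\<close>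

lemma laurent_functions_extend_zero:
  assumes f: "f \<in> laurent_functions"
    and ext: "\<And>p. (\<And>z c. (z, c) \<in> Y \<Longrightarrow> eval2 p z c = 0) \<Longrightarrow> eval2 p z0 c0 = 0"
    and Y: "\<And>z c. (z, c) \<in> Y \<Longrightarrow> z \<noteq> 0 \<and> f z c = 0" and "z0 \<noteq> 0"
  shows "f z0 c0 = 0"
proof -
  obtain p k where p: "\<And>z c. z \<noteq> 0 \<Longrightarrow> z ^ k * f z c = eval2 p z c"
    using f unfolding laurent_functions_def by blast
  have "eval2 p z0 c0 = 0" using Y p by (intro ext) (metis mult_zero_right)
  then show ?thesis using p[of z0 c0] \<open>z0 \<noteq> 0\<close> by simp
qed

lemma hyp_carrier [simp]: "hyp z \<in> carrier_mat 2 2" "hyp_conj z c \<in> carrier_mat 2 2"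
  by (simp_all add: hyp_def hyp_conj_def)

lemma hyp_mult: "hyp z * hyp z' = hyp (z * z')"
  by (simp add: hyp_def mat2_mult)

lemma hyp_conj_mult:
  "z \<noteq> 0 \<Longrightarrow> z' \<noteq> 0 \<Longrightarrow> hyp_conj z c * hyp_conj z' c = hyp_conj (z * z') c"
  by (simp add: hyp_conj_def mat2_mult mat2_eq_iff field_simps)

lemma hyp_1: "hyp 1 = 1\<^sub>m 2" "hyp_conj 1 c = 1\<^sub>m 2"
  by (simp_all add: hyp_def hyp_conj_def one_mat2)

text \<open>A trace other than 2 and -2 makes the eigenvalues \<open>z\<close> and 1 / z distinct;
  the columns of \<open>P\<close> are eigenvectors.\<close>

lemma diagonalize_mat2:
  assumes A: "A \<in> carrier_mat 2 2" "det A = 1" and tr: "A $$ (0, 0) + A $$ (1, 1) \<notin> {2, -2}"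
  obtains z P Q where "z \<noteq> 0" "z\<^sup>2 \<noteq> 1" "A $$ (0, 0) + A $$ (1, 1) = z + 1 / z"
    "P \<in> carrier_mat 2 2" "Q \<in> carrier_mat 2 2" "P * Q = 1\<^sub>m 2" "Q * P = 1\<^sub>m 2" "Q * A * P = hyp z"
proof -
  obtain a b c d where A_eq: "A = mat2 a b c d" using mat2_exhaust[OF A(1)] by metis
  have det: "a * d - b * c = 1" using A(2) by (simp add: A_eq det_mat2)
  have tr: "a + d \<noteq> 2" "a + d \<noteq> - 2" using tr by (auto simp: A_eq)
  have root: "z \<noteq> 0 \<and> z\<^sup>2 \<noteq> 1" if z: "z\<^sup>2 - (a + d) * z + 1 = 0" for z
  proof (intro conjI notI)
    assume "z = 0"
    then show False using z by simp
  next
    assume z2: "z\<^sup>2 = 1"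
    then have "a + d = ((a + d) * z) * z" by (simp add: power2_eq_square)
    also have "(a + d) * z = 2" using z by (simp add: z2)
    finally show False using z2 tr by (auto simp: power2_eq_1_iff)
  qed
  note result = that
  have conj: thesis
    if z: "z\<^sup>2 - (a + d) * z + 1 = 0"
      and P: "A * mat2 p q r s = mat2 p q r s * hyp z" "p * s - q * r \<noteq> 0" for z p q r s
  proof -
    let ?D = "p * s - q * r"
    define M N where "M = mat2 p q r s" and "N = mat2 (s / ?D) (- q / ?D) (- r / ?D) (p / ?D)"
    have inv: "M * N = 1\<^sub>m 2" "N * M = 1\<^sub>m 2"
      using P(2) by (simp_all add: M_def N_def mat2_mult one_mat2 mat2_eq_iff divide_simps)
    have MN: "M \<in> carrier_mat 2 2" "N \<in> carrier_mat 2 2" by (simp_all add: M_def N_def)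
    have "N * A * M = N * (M * hyp z)"
      using assoc_mult_mat[OF MN(2) A(1) MN(1)] P(1) by (simp add: M_def)
    also have "\<dots> = hyp z"
      using assoc_mult_mat[OF MN(2,1) hyp_carrier(1)[of z]] left_mult_one_mat[OF hyp_carrier(1)[of z]] inv(2)
      by simp
    finally have "N * A * M = hyp z" .
    moreover have "z \<noteq> 0" "z\<^sup>2 \<noteq> 1" using root[OF z] by auto
    moreover have "A $$ (0, 0) + A $$ (1, 1) = z + 1 / z"
      using z \<open>z \<noteq> 0\<close> by (simp add: A_eq field_simps power2_eq_square)
    ultimately show thesis using result[of z M N] inv MN by simp
  qed
  obtain z where z: "z\<^sup>2 - (a + d) * z + 1 = 0"
  proof -
    obtain z where "poly [:1, - (a + d), 1:] z = 0"
      using alg_closed_imp_poly_has_root[of "[:1, - (a + d), 1:]"] by auto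
    then show ?thesis using that[of z] by (simp add: power2_eq_square algebra_simps)
  qed
  note z' = root[OF z]
  have z1: "1 / z = a + d - z" using z z' by (simp add: field_simps power2_eq_square)
  have z2: "z \<noteq> 1 / z" using z' by (simp add: field_simps power2_eq_square)
  have ev: "(z - a) * (z - d) = b * c" "(1 / z - a) * (1 / z - d) = b * c"
    using z det unfolding z1 by (simp_all add: power2_eq_square algebra_simps)
  \<comment> \<open>The eigenvector for \<open>z\<close> is (b, z - a) if \<open>b\<close> is
    nonzero and (z - d, c) if \<open>c\<close> is nonzero; otherwise \<open>A\<close> is already
    diagonal.\<close>
  consider "b \<noteq> 0" | "c \<noteq> 0" | "b = 0" "c = 0" by blast
  then show thesis
  proof cases
    case 1
    show thesis
    proof (rule conj[OF z, of b b "z - a" "1 / z - a"])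
      show "A * mat2 b b (z - a) (1 / z - a) = mat2 b b (z - a) (1 / z - a) * hyp z"
        using ev by (simp add: A_eq hyp_def mat2_mult mat2_eq_iff algebra_simps)
      show "b * (1 / z - a) - b * (z - a) \<noteq> 0"
        using 1 z2 by (simp flip: right_diff_distrib)
    qed
  next
    case 2
    show thesis
    proof (rule conj[OF z, of "z - d" "1 / z - d" c c])
      show "A * mat2 (z - d) (1 / z - d) c c = mat2 (z - d) (1 / z - d) c c * hyp z"
        using ev by (simp add: A_eq hyp_def mat2_mult mat2_eq_iff algebra_simps)
      show "(z - d) * c - (1 / z - d) * c \<noteq> 0"
        using 2 z2 by (simp flip: left_diff_distrib)
    qed
  next
    case 3
    then have "a * d = 1" "a \<noteq> 0" using det by auto
    then have "d = 1 / a" by (simp add: field_simps)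
    show thesis
    proof (rule conj[of a 1 0 0 1])
      show "a\<^sup>2 - (a + d) * a + 1 = 0" using det 3 by (simp add: power2_eq_square algebra_simps)
      show "A * mat2 1 0 0 1 = mat2 1 0 0 1 * hyp a"
        using 3 \<open>d = 1 / a\<close> by (simp add: A_eq hyp_def mat2_mult)
    qed simp
  qed
qed

lemma conj_hom_SL:
  assumes \<phi>: "\<phi> \<in> hom \<Gamma> (SL_group n)"
    and PQ: "P \<in> carrier_mat n n" "Q \<in> carrier_mat n n" "P * Q = 1\<^sub>m n" "Q * P = 1\<^sub>m n"
  shows "(\<lambda>g. Q * \<phi> g * P) \<in> hom \<Gamma> (SL_group n)"
proof (rule homI)
  fix g assume g: "g \<in> carrier \<Gamma>"
  have "det P * det Q = 1" using det_mult[OF PQ(1,2)] PQ(3) by simp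
  then have "det (Q * \<phi> g * P) = 1"
    using hom_SL_D(1,2)[OF \<phi> g] PQ by (simp add: det_mult[of _ n] mult.commute)
  then show "Q * \<phi> g * P \<in> carrier (SL_group n)"
    using hom_SL_D(1)[OF \<phi> g] PQ by (auto simp: SL_def)
next
  fix g h assume gh: "g \<in> carrier \<Gamma>" "h \<in> carrier \<Gamma>"
  note C = hom_SL_D(1)[OF \<phi> gh(1)] hom_SL_D(1)[OF \<phi> gh(2)] PQ(1,2)
  have "Q * \<phi> g * P * (Q * \<phi> h * P) = Q * \<phi> g * (P * (Q * (\<phi> h * P)))"
    using C by (simp add: assoc_mult_mat[of _ n n _ n _ n])
  also have "P * (Q * (\<phi> h * P)) = (P * Q) * (\<phi> h * P)"
    using C by (intro assoc_mult_mat[symmetric]) auto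
  also have "\<dots> = \<phi> h * P" using C by (simp add: PQ)
  also have "Q * \<phi> g * (\<phi> h * P) = Q * (\<phi> g * \<phi> h) * P"
    using C by (simp add: assoc_mult_mat[of _ n n _ n _ n])
  finally show "Q * \<phi> (g \<otimes>\<^bsub>\<Gamma>\<^esub> h) * P = (Q * \<phi> g * P) \<otimes>\<^bsub>SL_group n\<^esub> (Q * \<phi> h * P)"
    using hom_SL_D(3)[OF \<phi> gh] by simp
qed

text \<open>A family of pairwise intersecting pairs of points is either a star or a triangle; a triangle
  is impossible because \<open>\<gamma>\<close> fixes one of its edges pointwise and no further vertex.\<close>

lemma (in group) exists_disjoint_translate:
  fixes \<alpha> :: "'a \<Rightarrow> 'p \<Rightarrow> 'p"
  assumes act: "\<And>g h r. g \<in> carrier G \<Longrightarrow> h \<in> carrier G \<Longrightarrow> \<alpha> (g \<otimes> h) r = \<alpha> g (\<alpha> h r)"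
    "\<And>r. \<alpha> \<one> r = r"
    and carrier: "\<gamma> \<in> carrier G" "A \<subseteq> carrier G"
    and pq: "p \<noteq> q" "\<alpha> \<gamma> p = p" "\<alpha> \<gamma> q = q"
    and fix_only: "\<And>g e. g \<in> carrier G \<Longrightarrow> e \<in> {p, q} \<Longrightarrow> \<alpha> \<gamma> (\<alpha> g e) = \<alpha> g e \<Longrightarrow> \<alpha> g e \<in> {p, q}"
    and meet: "\<And>s u g h. s \<in> A \<Longrightarrow> u \<in> A \<Longrightarrow> {g, h} \<subseteq> {\<one>, s, u, u \<otimes> s, \<gamma> \<otimes> s} \<Longrightarrow>
      {\<alpha> (inv g \<otimes> h) p, \<alpha> (inv g \<otimes> h) q} \<inter> {p, q} \<noteq> {}"
  shows "(\<forall>s\<in>A. {\<alpha> s p, \<alpha> s q} = {p, q}) \<or> (\<exists>r\<in>{p, q}. \<forall>s\<in>A. \<alpha> s r = r)"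
proof (rule ccontr)
  assume neg: "\<not> ?thesis"
  then obtain s where s: "s \<in> A" "{\<alpha> s p, \<alpha> s q} \<noteq> {p, q}" by blast
  have inj: "r = r'" if "\<alpha> g r = \<alpha> g r'" "g \<in> carrier G" for g r r'
    using that act(1)[of "inv g" g] act(2) by (metis inv_closed l_inv)
  define E where "E g = {\<alpha> g p, \<alpha> g q}" for g
  have E_meet: "E g \<inter> E h \<noteq> {}"
    if u: "u \<in> A" and gh: "{g, h} \<subseteq> {\<one>, s, u, u \<otimes> s, \<gamma> \<otimes> s}" for u g h
  proof -
    have gh_carrier: "g \<in> carrier G" "h \<in> carrier G"
      using that s(1) carrier by auto
    obtain e where e: "e \<in> {p, q}" "\<alpha> (inv g \<otimes> h) e \<in> {p, q}"
      using meet[OF s(1) u gh] by blast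
    have "\<alpha> h e = \<alpha> g (\<alpha> (inv g \<otimes> h) e)"
      using gh_carrier act(1)[of g "inv g \<otimes> h" e] by (simp flip: m_assoc)
    then show ?thesis using e by (auto simp: E_def)
  qed
  have E_one: "E \<one> = {p, q}" by (simp add: E_def act(2))
  have s_carrier: "s \<in> carrier G" using s(1) carrier by blast
  \<comment> \<open>\<open>x\<close> is a vertex shared by \<open>E \<one>\<close> and
    \<open>E s\<close>, so these edges are {x, y} and {x, r}.\<close>
  have False if xy: "{x, y} = {p, q}" "x \<noteq> y" "x \<in> E s" for x y
  proof -
    have "\<alpha> s p \<noteq> \<alpha> s q" using inj s_carrier pq(1) by blast
    then obtain r where r: "E s = {x, r}" "r \<noteq> x"
      using xy(3) unfolding E_def by (metis insert_commute insert_iff singletonD)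
    then have "r \<noteq> y" using s(2) xy(1) by (auto simp: E_def)
    have "x \<in> {p, q}" "y \<in> {p, q}" using xy(1) by blast+
    then have \<gamma>_xy: "\<alpha> \<gamma> x = x" "\<alpha> \<gamma> y = y" using pq(2,3) by auto
    obtain u where u: "u \<in> A" "\<alpha> u x \<noteq> x" using neg \<open>x \<in> {p, q}\<close> by blast
    have u_carrier: "u \<in> carrier G" using u(1) carrier by blast
    have Eu: "E u = {\<alpha> u x, \<alpha> u y}" using xy(1) by (auto simp: E_def doubleton_eq_iff)
    have "E (u \<otimes> s) = \<alpha> u ` E s" using u_carrier s_carrier by (simp add: E_def act(1))
    then have Eus: "E (u \<otimes> s) = {\<alpha> u x, \<alpha> u r}" using r by simp
    \<comment> \<open>If both edges contained \<open>x\<close>, then \<open>u\<close>, which moves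
      \<open>x\<close>, would send both \<open>y\<close> and \<open>r\<close> to
      \<open>x\<close>.\<close>
    obtain g where g: "g \<in> {u, u \<otimes> s}" "x \<notin> E g"
    proof -
      have "x \<notin> E u \<or> x \<notin> E (u \<otimes> s)"
        using u(2) inj[of u y r] \<open>r \<noteq> y\<close> u_carrier unfolding Eu Eus by auto
      then show ?thesis using that by blast
    qed
    have "E g \<inter> E \<one> \<noteq> {}" "E g \<inter> E s \<noteq> {}" "E g \<inter> E (\<gamma> \<otimes> s) \<noteq> {}"
      using g(1) by (intro E_meet[OF u(1)]; auto)+
    then have "y \<in> E g" "r \<in> E g" using g(2) unfolding E_one xy(1)[symmetric] r(1) by blast+
    \<comment> \<open>An edge that avoids \<open>x\<close> but meets {x, y} and {x, r} closes a
      triangle. The translate of {x, r} by \<gamma> keeps \<open>x\<close>, so it can meet {y, r}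
      only in the image of \<open>r\<close>.\<close>
    then have Eg: "E g = {y, r}" using \<open>r \<noteq> y\<close> unfolding E_def by blast
    have "E (\<gamma> \<otimes> s) = \<alpha> \<gamma> ` E s" using carrier s_carrier by (simp add: E_def act(1))
    also have "\<dots> = {x, \<alpha> \<gamma> r}" using r(1) \<gamma>_xy by simp
    finally have Egs: "E (\<gamma> \<otimes> s) = {x, \<alpha> \<gamma> r}" .
    have "x \<notin> {y, r}" using r(2) xy(2) by simp
    then have "\<alpha> \<gamma> r \<in> {y, r}"
      using \<open>E g \<inter> E (\<gamma> \<otimes> s) \<noteq> {}\<close> unfolding Eg Egs
      by (metis Int_insert_right Int_empty_right)
    then show False
    proof
      assume "\<alpha> \<gamma> r = y"
      then have "\<alpha> \<gamma> r = \<alpha> \<gamma> y" using \<gamma>_xy by simp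
      then show False using inj carrier(1) \<open>r \<noteq> y\<close> by blast
    next
      assume "\<alpha> \<gamma> r \<in> {r}"
      moreover have "r \<in> E s" using r(1) by simp
      then obtain e where "e \<in> {p, q}" "r = \<alpha> s e" unfolding E_def by blast
      ultimately have "r \<in> {p, q}" using fix_only[OF s_carrier] by blast
      then show False using r(2) \<open>r \<noteq> y\<close> xy(1) by blast
    qed
  qed
  moreover have "E \<one> \<inter> E s \<noteq> {}" using s(1) by (intro E_meet[of s]) auto
  ultimately show False using pq(1) unfolding E_one by (metis Int_iff doubleton_eq_iff ex_in_conv insert_iff singletonD)
qed

section \<open>Moving the eigenlines of a diagonal matrix\<close>

text \<open>For an invertible matrix: neither coordinate axis is mapped to a coordinate
  axis.\<close>

definition nonvanishing :: "complex mat \<Rightarrow> bool" where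
  "nonvanishing A \<longleftrightarrow> (\<forall>i<2. \<forall>j<2. A $$ (i, j) \<noteq> 0)"

lemma nonvanishing_mat2 [simp]:
  "nonvanishing (mat2 a b c d) \<longleftrightarrow> a \<noteq> 0 \<and> b \<noteq> 0 \<and> c \<noteq> 0 \<and> d \<noteq> 0"
  by (auto simp: nonvanishing_def numeral_2_eq_2 less_Suc_eq all_conj_distrib)

text \<open>Points of the projective line are taken as lines through the origin, on which matrices
  act by images.\<close>

definition coord_axis :: "bool \<Rightarrow> (complex \<times> complex) set" where
  "coord_axis b = range (\<lambda>k. if b then (k, 0) else (0, k))"

lemma act2_axis: "act2 (mat2 a b c d) ` coord_axis s = range (\<lambda>k. if s then (a * k, c * k) else (b * k, d * k))"
  by (cases s) (auto simp: coord_axis_def image_image)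

lemma range_line_eq_axis:
  assumes "range (\<lambda>k. (a * k, c * k)) = coord_axis s"
  shows "(if s then c else a) = 0"
proof -
  have "(a * 1, c * 1) \<in> coord_axis s" using assms by blast
  then show ?thesis by (cases s) (auto simp: coord_axis_def)
qed

lemma axis_eq_range_line:
  fixes a c :: complex
  assumes "(a = 0) \<noteq> (c = 0)"
  shows "range (\<lambda>k. (a * k, c * k)) \<in> {coord_axis True, coord_axis False}"
proof (cases "c = 0")
  case True
  have "(k, 0) \<in> range (\<lambda>k. (a * k, c * k))" for k
    using True assms by (intro image_eqI[of _ _ "k / a"]) auto
  then have "range (\<lambda>k. (a * k, c * k)) = coord_axis True" using True by (auto simp: coord_axis_def)
  then show ?thesis by simp
next
  case False
  have "(0, k) \<in> range (\<lambda>k. (a * k, c * k))" for k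
    using False assms by (intro image_eqI[of _ _ "k / c"]) auto
  then have "range (\<lambda>k. (a * k, c * k)) = coord_axis False" using False assms by (auto simp: coord_axis_def)
  then show ?thesis by simp
qed

text \<open>If no listed translate of the pair of eigenlines of \<open>\<gamma>\<close> is disjoint from it, then the images
  of \<open>a\<close> and \<open>b\<close> are both monomial or both triangular, so their squares commute up to
  unipotents.\<close>

lemma (in group) exists_nonvanishing:
  assumes \<phi>: "\<phi> \<in> hom G (SL_group 2)" and ab: "a \<in> carrier G" "b \<in> carrier G"
    and \<gamma>: "\<gamma> \<in> carrier G" "\<gamma> \<otimes> (b \<otimes> b \<otimes> (a \<otimes> a)) = a \<otimes> a \<otimes> (b \<otimes> b)"
    and z: "\<phi> \<gamma> = hyp z" "z \<noteq> 0" "z\<^sup>2 \<noteq> 1"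
  shows "\<exists>s\<in>{a, b}. \<exists>u\<in>{a, b}. \<exists>g\<in>{\<one>, s, u, u \<otimes> s, \<gamma> \<otimes> s}. \<exists>h\<in>{\<one>, s, u, u \<otimes> s, \<gamma> \<otimes> s}.
    nonvanishing (\<phi> (inv g \<otimes> h))"
proof (rule ccontr)
  assume neg: "\<not> ?thesis"
  note \<phi>_mult = hom_SL_D(3)[OF \<phi>]
  have \<phi>_mat2: "\<exists>k l m n. \<phi> g = mat2 k l m n \<and> k * n - l * m = 1" if "g \<in> carrier G" for g
    using mat2_exhaust[OF hom_SL_D(1)[OF \<phi> that]] hom_SL_D(2)[OF \<phi> that] by (metis det_mat2)
  have "\<phi> \<one> = 1\<^sub>m 2"
    using hom_one[OF \<phi> is_group group_SL] by simp
  define \<alpha> where "\<alpha> g r = act2 (\<phi> g) ` r" for g r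
  have act: "\<alpha> (g \<otimes> h) r = \<alpha> g (\<alpha> h r)" if "g \<in> carrier G" "h \<in> carrier G" for g h r
    using act2_mult[OF hom_SL_D(1)[OF \<phi> that(1)] hom_SL_D(1)[OF \<phi> that(2)]] \<phi>_mult[OF that]
    by (simp add: \<alpha>_def image_image)
  have act_one: "\<alpha> \<one> r = r" for r
    using \<open>\<phi> \<one> = 1\<^sub>m 2\<close> by (simp add: \<alpha>_def one_mat2 act2_def)
  have axis_ne: "coord_axis True \<noteq> coord_axis False"
  proof -
    have "(1, 0) \<in> coord_axis True" "(1, 0) \<notin> coord_axis False" by (auto simp: coord_axis_def)
    then show ?thesis by metis
  qed
  have dichotomy: "(\<forall>s\<in>{a, b}. {\<alpha> s (coord_axis True), \<alpha> s (coord_axis False)} = {coord_axis True, coord_axis False})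
    \<or> (\<exists>r\<in>{coord_axis True, coord_axis False}. \<forall>s\<in>{a, b}. \<alpha> s r = r)"
  proof (rule exists_disjoint_translate[of \<alpha> \<gamma>])
    show "{a, b} \<subseteq> carrier G" "\<gamma> \<in> carrier G" using ab \<gamma> by auto
    have "\<alpha> \<gamma> (coord_axis True) = (\<lambda>k. (k, 0)) ` range (\<lambda>k. z * k)"
      "\<alpha> \<gamma> (coord_axis False) = (\<lambda>k. (0, k)) ` range (\<lambda>k. k / z)"
      by (simp_all add: \<alpha>_def z(1) hyp_def act2_axis image_image)
    moreover have "range (\<lambda>k. z * k) = UNIV"
      by (rule surjI[of _ "\<lambda>k. k / z"]) (use z(2) in simp)
    moreover have "range (\<lambda>k. k / z) = UNIV"
      by (rule surjI[of _ "\<lambda>k. z * k"]) (use z(2) in simp)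
    ultimately show "\<alpha> \<gamma> (coord_axis True) = coord_axis True" "\<alpha> \<gamma> (coord_axis False) = coord_axis False"
      by (simp_all add: coord_axis_def)
    \<comment> \<open>A diagonal matrix with distinct eigenvalues preserves no line but the
      axes.\<close>
    show "\<alpha> g e \<in> {coord_axis True, coord_axis False}"
      if g: "g \<in> carrier G" and e: "e \<in> {coord_axis True, coord_axis False}" and fixed: "\<alpha> \<gamma> (\<alpha> g e) = \<alpha> g e" for g e
    proof -
      obtain k l m n where klmn: "\<phi> g = mat2 k l m n" "k * n - l * m = 1" using \<phi>_mat2[OF g] by blast
      obtain v w where vw: "\<alpha> g e = range (\<lambda>t. (v * t, w * t))" "v \<noteq> 0 \<or> w \<noteq> 0"
      proof -
        have "k \<noteq> 0 \<or> m \<noteq> 0" "l \<noteq> 0 \<or> n \<noteq> 0" using klmn(2) by auto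
        then show thesis
          using e that[of k m] that[of l n] by (auto simp: \<alpha>_def klmn(1) act2_axis)
      qed
      have "(z * (v * 1), (w * 1) / z) \<in> \<alpha> \<gamma> (\<alpha> g e)"
      proof -
        have "act2 (hyp z) (v * 1, w * 1) \<in> act2 (hyp z) ` \<alpha> g e"
          unfolding vw(1) by (intro imageI rangeI)
        then show ?thesis by (simp add: \<alpha>_def z(1) hyp_def)
      qed
      then obtain t where t: "z * v = v * t" "w / z = w * t" unfolding fixed unfolding vw(1) by auto
      have "v = 0 \<or> w = 0"
      proof (rule ccontr)
        assume "\<not> (v = 0 \<or> w = 0)"
        then have "v \<noteq> 0" "w \<noteq> 0" "z = t" using t(1) by auto
        then have "w * (z * z) = w * 1" using t(2) z(2) by (simp add: divide_eq_eq mult_ac)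
        then show False using \<open>w \<noteq> 0\<close> z(3) by (simp add: power2_eq_square)
      qed
      then show ?thesis unfolding vw(1) using vw(2) by (intro axis_eq_range_line) auto
    qed
    show "{\<alpha> (inv g \<otimes> h) (coord_axis True), \<alpha> (inv g \<otimes> h) (coord_axis False)} \<inter> {coord_axis True, coord_axis False} \<noteq> {}"
      if "s \<in> {a, b}" "u \<in> {a, b}" "{g, h} \<subseteq> {\<one>, s, u, u \<otimes> s, \<gamma> \<otimes> s}" for s u g h
    proof -
      have "inv g \<otimes> h \<in> carrier G" using that ab \<gamma>(1) by auto
      then obtain k l m n where klmn: "\<phi> (inv g \<otimes> h) = mat2 k l m n" "k * n - l * m = 1"
        using \<phi>_mat2 by blast
      moreover have "g \<in> {\<one>, s, u, u \<otimes> s, \<gamma> \<otimes> s}" "h \<in> {\<one>, s, u, u \<otimes> s, \<gamma> \<otimes> s}"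
        using that(3) by (simp_all only: insert_subset)
      then have "\<not> nonvanishing (\<phi> (inv g \<otimes> h))" using neg that(1,2) by meson
      \<comment> \<open>By determinant 1, a zero entry has a nonzero entry in the same column, and
        that column lies on an axis.\<close>
      ultimately have "((k = 0) \<noteq> (m = 0)) \<or> ((l = 0) \<noteq> (n = 0))" by auto
      then show ?thesis
        using axis_eq_range_line[of k m] axis_eq_range_line[of l n]
        by (auto simp: \<alpha>_def klmn(1) act2_axis)
    qed
  qed (use act act_one axis_ne in auto)
  obtain k l m n where A: "\<phi> a = mat2 k l m n" "k * n - l * m = 1" using \<phi>_mat2[OF ab(1)] by blast
  obtain k' l' m' n' where B: "\<phi> b = mat2 k' l' m' n'" "k' * n' - l' * m' = 1"
    using \<phi>_mat2[OF ab(2)] by blast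
  have mono: "l = 0 \<and> m = 0 \<or> k = 0 \<and> n = 0"
    if "{\<alpha> s (coord_axis True), \<alpha> s (coord_axis False)} = {coord_axis True, coord_axis False}" "\<phi> s = mat2 k l m n" for s k l m n
  proof -
    have "\<alpha> s (coord_axis True) = range (\<lambda>t. (k * t, m * t))"
      "\<alpha> s (coord_axis False) = range (\<lambda>t. (l * t, n * t))"
      by (simp_all add: \<alpha>_def that(2) act2_axis)
    then show ?thesis
      using that(1) range_line_eq_axis[of k m True] range_line_eq_axis[of l n False]
        range_line_eq_axis[of k m False] range_line_eq_axis[of l n True]
      unfolding doubleton_eq_iff by simp metis
  qed
  have tri: "(if r then m else l) = 0"
    if "\<alpha> s (coord_axis r) = coord_axis r" "\<phi> s = mat2 k l m n" for r s k l m n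
    using that range_line_eq_axis[of k m True] range_line_eq_axis[of l n False]
    by (cases r) (simp_all add: \<alpha>_def act2_axis)
  have shape: "(l = 0 \<and> m = 0 \<or> k = 0 \<and> n = 0) \<and> (l' = 0 \<and> m' = 0 \<or> k' = 0 \<and> n' = 0)
      \<or> m = 0 \<and> m' = 0 \<or> l = 0 \<and> l' = 0"
    using dichotomy
  proof (elim disjE bexE)
    assume *: "\<forall>s\<in>{a, b}. {\<alpha> s (coord_axis True), \<alpha> s (coord_axis False)} = {coord_axis True, coord_axis False}"
    have "l = 0 \<and> m = 0 \<or> k = 0 \<and> n = 0" by (rule mono[OF _ A(1)]) (use * in simp)
    moreover have "l' = 0 \<and> m' = 0 \<or> k' = 0 \<and> n' = 0" by (rule mono[OF _ B(1)]) (use * in simp)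
    ultimately show ?thesis by blast
  next
    fix r assume "r \<in> {coord_axis True, coord_axis False}" and *: "\<forall>s\<in>{a, b}. \<alpha> s r = r"
    then obtain i where "r = coord_axis i" by blast
    then have "(if i then m else l) = 0" "(if i then m' else l') = 0"
      using * by (intro tri[OF _ A(1)] tri[OF _ B(1)]; simp)+
    then show ?thesis by (auto split: if_splits)
  qed
  \<comment> \<open>In the monomial case both squares are diagonal; in the triangular case diagonals
    multiply entrywise. Either way the two products have the same nonzero diagonal entries, which
    forces \<open>z = 1\<close>.\<close>
  have "hyp z * (\<phi> b * \<phi> b * (\<phi> a * \<phi> a)) = \<phi> a * \<phi> a * (\<phi> b * \<phi> b)"
    using arg_cong[OF \<gamma>(2), of \<phi>] ab \<gamma>(1) z(1) by (simp add: \<phi>_mult)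
  then have "z = 1"
    using shape A(2) B(2) by (auto simp: A(1) B(1) hyp_def mat2_mult mat2_eq_iff)
  then show False using z(3) by simp
qed

section \<open>Normal form of a pair of conjugate matrices\<close>

text \<open>Conjugation by a diagonal matrix fixes \<open>hyp z\<close> and scales the off-diagonal
  entries of the other matrix by reciprocal factors. The remaining invariant is c = k n, with c - 1
  = l m, so nonzero entries of \<open>g\<close> exclude 0 and 1.\<close>

lemma hyp_conj_normal_form:
  assumes "g \<in> SL 2" "nonvanishing g" "h \<in> carrier_mat 2 2" "g * h = 1\<^sub>m 2" "z \<noteq> 0"
  obtains P Q c where "P \<in> carrier_mat 2 2" "Q \<in> carrier_mat 2 2" "P * Q = 1\<^sub>m 2" "Q * P = 1\<^sub>m 2"
    "c \<noteq> 0" "c \<noteq> 1" "Q * hyp z * P = hyp z" "Q * (g * hyp z * h) * P = hyp_conj z c"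
proof -
  obtain k l m n where g: "g = mat2 k l m n"
    using mat2_exhaust[of g] assms(1) by (auto simp: SL_def)
  have klmn: "k \<noteq> 0" "l \<noteq> 0" "m \<noteq> 0" "n \<noteq> 0" "k * n - l * m = 1"
    using assms(1,2) by (auto simp: g SL_def det_mat2)
  define g' where "g' = mat2 n (- l) (- m) k"
  have g': "g' * g = 1\<^sub>m 2" "g' \<in> carrier_mat 2 2"
    using klmn(5) by (auto simp: g g'_def mat2_mult one_mat2 mat2_eq_iff algebra_simps)
  have "h = g'"
  proof -
    have "g' * (g * h) = g' * g * h"
      using g' assms by (intro assoc_mult_mat[symmetric]) (auto simp: SL_def)
    then show ?thesis
      using g' assms(3,4) right_mult_one_mat[OF g'(2)] left_mult_one_mat[OF assms(3)] by simp
  qed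
  \<comment> \<open>The scale that turns the lower left entry m n (z - 1 / z) into z - 1 /
    z.\<close>
  define d where "d = csqrt (1 / (m * n))"
  have d: "d * d = 1 / (m * n)" unfolding d_def using power2_csqrt by (simp add: power2_eq_square)
  then have "d \<noteq> 0" using klmn by auto
  have dmn: "d * d * (m * n) = 1" using d klmn by simp
  define c where "c = k * n"
  have c: "1 - c = - (l * m)" using klmn(5) by (simp add: c_def algebra_simps)
  show ?thesis
  proof (rule that[of "mat2 d 0 0 (1 / d)" "mat2 (1 / d) 0 0 d" c])
    show "c \<noteq> 0" using klmn by (simp add: c_def)
    show "c \<noteq> 1" using klmn c by auto
    have e10: "d * (m * n * (z - 1 / z)) * d = z - 1 / z"
      using dmn by (metis mult.assoc mult.commute mult_1)
    have e01: "1 / d * (- (k * l) * (z - 1 / z)) * (1 / d) = c * (1 - c) * (z - 1 / z)"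
    proof -
      have "c * (1 - c) = - (k * l) * (m * n)" unfolding c by (simp add: c_def)
      also have "m * n = 1 / (d * d)" using d klmn by simp
      finally show ?thesis by simp
    qed
    have "g * hyp z * h = mat2 (c * z - (c - 1) / z) (- (k * l) * (z - 1 / z))
        (m * n * (z - 1 / z)) ((1 - c) * z + c / z)"
    proof -
      have c': "c - 1 = l * m" using c by (simp add: algebra_simps)
      show ?thesis unfolding c c'
        by (simp add: g \<open>h = g'\<close> g'_def hyp_def mat2_mult mat2_eq_iff c_def algebra_simps)
    qed
    then show "mat2 (1 / d) 0 0 d * (g * hyp z * h) * mat2 d 0 0 (1 / d) = hyp_conj z c"
      using \<open>d \<noteq> 0\<close> e10 e01 by (simp add: hyp_conj_def mat2_mult mat2_eq_iff)
  qed (use \<open>d \<noteq> 0\<close> in \<open>auto simp: mat2_mult one_mat2 hyp_def\<close>)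
qed

lemma (in group) hom_SL2_inv:
  assumes \<phi>: "\<phi> \<in> hom G (SL_group 2)" and x: "x \<in> carrier G" and B: "B \<in> carrier_mat 2 2" "B * \<phi> x = 1\<^sub>m 2"
  shows "\<phi> (inv x) = B"
proof -
  have C: "\<phi> x \<in> carrier_mat 2 2" "\<phi> (inv x) \<in> carrier_mat 2 2"
    using hom_SL_D(1)[OF \<phi>] x by auto
  have "\<phi> x * \<phi> (inv x) = \<phi> \<one>" using hom_SL_D(3)[OF \<phi> x inv_closed[OF x]] x by simp
  also have "\<dots> = 1\<^sub>m 2" using hom_one[OF \<phi> is_group group_SL] by simp
  finally have inv: "\<phi> x * \<phi> (inv x) = 1\<^sub>m 2" .
  have "B * (\<phi> x * \<phi> (inv x)) = B * \<phi> x * \<phi> (inv x)"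
    using B C by (intro assoc_mult_mat[symmetric])
  then show ?thesis using right_mult_one_mat[OF B(1)] left_mult_one_mat[OF C(2)] by (simp add: inv B(2))
qed

lemma (in group) hom_SL2_word_val:
  assumes \<phi>: "\<phi> \<in> hom G (SL_group 2)" and xy: "x \<in> carrier G" "y \<in> carrier G" "x \<noteq> y"
    and \<mu>: "\<phi> x = hyp \<mu>" "\<phi> y = hyp_conj \<mu> c" "\<mu> \<noteq> 0" and w: "fst ` set w \<subseteq> {x, y}"
  shows "\<phi> (word_val G w) = hyp_word x \<mu> c w"
  using w
proof (induction w)
  case Nil
  then show ?case using hom_one[OF \<phi> is_group group_SL] by (simp add: hyp_word_def)
next
  case (Cons l w)
  have "\<phi> (inv x) = hyp (1 / \<mu>)"
    using \<mu> by (intro hom_SL2_inv[OF \<phi> xy(1)]) (simp_all add: hyp_mult hyp_1)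
  moreover have "\<phi> (inv y) = hyp_conj (1 / \<mu>) c"
    using \<mu> by (intro hom_SL2_inv[OF \<phi> xy(2)]) (simp_all add: hyp_conj_mult hyp_1)
  ultimately have "\<phi> (letter_val G l) = hyp_letter x \<mu> c l"
    using Cons.prems xy(3) \<mu> by (auto simp: letter_val_def hyp_letter_def Let_def)
  moreover have "letter_val G l \<in> carrier G" "word_val G w \<in> carrier G"
    using Cons.prems xy by (auto intro!: letter_val_closed word_val_closed)
  ultimately show ?case
    using Cons hom_SL_D(3)[OF \<phi>] by (simp add: hyp_word_def)
qed

section \<open>From representations to free subgroups\<close>

text \<open>Parameters of the representations with both elements in normal form. At c = 0 and c = 1
  the two matrices would share an eigenline.\<close>

definition conj_pairs :: "('a, 'b) monoid_scheme \<Rightarrow> 'a \<Rightarrow> 'a \<Rightarrow> (complex \<times> complex) set" where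
  "conj_pairs G \<gamma> \<delta> = {(z, c). z \<noteq> 0 \<and> c \<noteq> 0 \<and> c \<noteq> 1 \<and>
     (\<exists>\<phi>\<in>hom G (SL_group 2). \<phi> \<gamma> = hyp z \<and> \<phi> \<delta> = hyp_conj z c)}"

lemma (in group) hom_SL2_pow:
  assumes \<phi>: "\<phi> \<in> hom G (SL_group 2)" and "x \<in> carrier G" "z \<noteq> 0"
  shows "\<phi> x = hyp z \<Longrightarrow> \<phi> (x [^] n) = hyp (z ^ n)"
    "\<phi> x = hyp_conj z c \<Longrightarrow> \<phi> (x [^] (n :: nat)) = hyp_conj (z ^ n) c"
proof -
  have "\<phi> \<one> = 1\<^sub>m 2" using hom_one[OF \<phi> is_group group_SL] by simp
  then show "\<phi> x = hyp z \<Longrightarrow> \<phi> (x [^] n) = hyp (z ^ n)"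
    "\<phi> x = hyp_conj z c \<Longrightarrow> \<phi> (x [^] n) = hyp_conj (z ^ n) c"
    using assms(2,3) hom_SL_D(3)[OF \<phi>]
    by (induction n) (simp_all add: hyp_1 hyp_mult hyp_conj_mult mult.commute)
qed

text \<open>If \<open>\<gamma>\<^sup>n\<close> and \<open>\<delta>\<^sup>n\<close> satisfied a relation for every \<open>n\<close>, these relations would carry over to a
  point \<open>(z, c)\<close> with \<open>\<bar>z\<bar> > 1\<close>, where they contradict the ping-pong lemma.\<close>

lemma (in group) infinite_conj_pairs_imp_free:
  assumes \<gamma>\<delta>: "\<gamma> \<in> carrier G" "\<delta> \<in> carrier G" and inf: "infinite (fst ` conj_pairs G \<gamma> \<delta>)"
  shows "contains_nonabelian_free_group G"
proof -
  define Y where "Y = conj_pairs G \<gamma> \<delta>"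
  have Y: "z \<noteq> 0" "c \<noteq> 0" "c \<noteq> 1" if "(z, c) \<in> Y" for z c
    using that by (auto simp: Y_def conj_pairs_def)
  obtain z0 c0 where zc0: "norm z0 > 1" "c0 \<noteq> 0" "c0 \<noteq> 1"
    and ext: "\<And>p. (\<And>z c. (z, c) \<in> Y \<Longrightarrow> eval2 p z c = 0) \<Longrightarrow> eval2 p z0 c0 = 0"
    using plane_curve_large_point[of Y] inf Y by (metis Y_def)
  have "z0 \<noteq> 0" using zc0(1) by auto
  \<comment> \<open>\<open>n\<close> depends on the large point alone, before any word is
    considered.\<close>
  obtain n :: nat where n: "n > 0"
    and free: "\<And>(x :: 'a) y w. x \<noteq> y \<Longrightarrow> reduced w \<Longrightarrow> w \<noteq> [] \<Longrightarrow> fst ` set w \<subseteq> {x, y} \<Longrightarrow>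
      hyp_word x (z0 ^ n) c0 w \<noteq> 1\<^sub>m 2"
    using exists_free_power[OF zc0] by blast
  define x y where "x = \<gamma> [^] n" and "y = \<delta> [^] n"
  have xy: "x \<in> carrier G" "y \<in> carrier G" using \<gamma>\<delta> by (simp_all add: x_def y_def)
  have rep: "\<exists>\<phi>\<in>hom G (SL_group 2). \<phi> x = hyp (z ^ n) \<and> \<phi> y = hyp_conj (z ^ n) c"
    if zc: "(z, c) \<in> Y" for z c
  proof -
    obtain \<phi> where "\<phi> \<in> hom G (SL_group 2)" "\<phi> \<gamma> = hyp z" "\<phi> \<delta> = hyp_conj z c"
      using zc by (auto simp: Y_def conj_pairs_def)
    then show ?thesis
      using hom_SL2_pow \<gamma>\<delta> Y(1)[OF zc] unfolding x_def y_def by blast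
  qed
  \<comment> \<open>Otherwise the lower left entries, 0 and \<open>z ^ n - 1 / z ^ n\<close>, agree
    on \<open>Y\<close>, and only finitely many \<open>z\<close> can occur.\<close>
  have "x \<noteq> y"
  proof
    assume "x = y"
    have "z ^ (2 * n) = 1" if zc: "(z, c) \<in> Y" for z c
    proof -
      have "hyp (z ^ n) = hyp_conj (z ^ n) c" using rep[OF zc] \<open>x = y\<close> by auto
      then have "z ^ n = 1 / z ^ n" by (simp add: hyp_def hyp_conj_def mat2_eq_iff)
      then have "z ^ n * z ^ n = 1" using Y(1)[OF zc] by (simp add: field_simps)
      then show ?thesis by (simp add: mult_2 power_add)
    qed
    then have "fst ` Y \<subseteq> {z. z ^ (2 * n) = 1}" by auto
    moreover have "finite {z :: complex. z ^ (2 * n) = 1}"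
      using n by (intro finite_roots_unity) auto
    ultimately show False using inf finite_subset by (auto simp: Y_def)
  qed
  show ?thesis
  proof (rule contains_nonabelian_free_groupI[OF xy \<open>x \<noteq> y\<close>])
    fix w assume w: "reduced w" "w \<noteq> []" "fst ` set w \<subseteq> {x, y}"
    show "word_val G w \<noteq> \<one>"
    proof
      assume one: "word_val G w = \<one>"
      have word: "hyp_word x (z ^ n) c w = 1\<^sub>m 2" if zc: "(z, c) \<in> Y" for z c
      proof -
        obtain \<phi> where \<phi>: "\<phi> \<in> hom G (SL_group 2)" "\<phi> x = hyp (z ^ n)" "\<phi> y = hyp_conj (z ^ n) c"
          using rep[OF zc] by blast
        then have "\<phi> (word_val G w) = hyp_word x (z ^ n) c w"
          using w(3) Y(1)[OF zc] by (intro hom_SL2_word_val[OF _ xy \<open>x \<noteq> y\<close>]) auto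
        then show ?thesis using one hom_one[OF \<phi>(1) is_group group_SL] by simp
      qed
      \<comment> \<open>Each entry of the word minus that of the identity is a Laurent function
        vanishing on \<open>Y\<close>, hence at the large point.\<close>
      have "hyp_word x (z0 ^ n) c0 w $$ (i, j) - 1\<^sub>m 2 $$ (i, j) = 0" if ij: "i < 2" "j < 2" for i j
        by (rule laurent_functions_extend_zero[OF laurent_functions_diff[OF
              hyp_word_laurent[OF ij] laurent_functions_const] ext _ \<open>z0 \<noteq> 0\<close>])
          (use word Y(1) in auto)
      then have "hyp_word x (z0 ^ n) c0 w = 1\<^sub>m 2"
        using carrier_matD[OF hyp_word_carrier[of x "z0 ^ n" c0 w]] by (intro eq_matI) auto
      then show False using free \<open>x \<noteq> y\<close> w by blast
    qed
  qed
qed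

text \<open>\<open>L\<close> is finite, so once \<open>Z\<close> is infinite a single
  \<open>g\<close> accounts for infinitely many eigenvalues. Were \<open>Z\<close> finite, Borel's
  property would yield a trace outside the finitely many belonging to \<open>Z\<close>.\<close>

lemma (in group) borel_property_squares:
  assumes "borel_property G" "torsion_free_group G" and ab: "a \<in> carrier G" "b \<in> carrier G"
    and noncomm: "a \<otimes> a \<otimes> (b \<otimes> b) \<noteq> b \<otimes> b \<otimes> (a \<otimes> a)"
  shows "contains_nonabelian_free_group G"
proof -
  define \<gamma> where "\<gamma> = a \<otimes> a \<otimes> (b \<otimes> b) \<otimes> inv (b \<otimes> b \<otimes> (a \<otimes> a))"
  have \<gamma>: "\<gamma> \<in> carrier G" "\<gamma> \<otimes> (b \<otimes> b \<otimes> (a \<otimes> a)) = a \<otimes> a \<otimes> (b \<otimes> b)"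
    using ab by (simp_all add: \<gamma>_def inv_solve_right m_assoc)
  then have "\<gamma> \<noteq> \<one>" using noncomm ab by auto
  define M where "M s u = {\<one>, s, u, u \<otimes> s, \<gamma> \<otimes> s}" for s u
  define L where "L = (\<Union>s\<in>{a, b}. \<Union>u\<in>{a, b}. \<Union>g\<in>M s u. \<Union>h\<in>M s u. {inv g \<otimes> h})"
  have "finite L" by (simp add: L_def M_def)
  have L_carrier: "L \<subseteq> carrier G" using ab \<gamma>(1) by (auto simp: L_def M_def)
  define Z where "Z = (\<Union>g\<in>L. fst ` conj_pairs G \<gamma> (g \<otimes> \<gamma> \<otimes> inv g))"
  have "infinite Z"
  proof
    assume "finite Z"
    \<comment> \<open>The traces to avoid: those of eigenvalues in \<open>Z\<close>, and 2 and -2,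
      where the eigenvalues coincide.\<close>
    define F where "F = {2, -2} \<union> (\<lambda>z. z + 1 / z) ` Z"
    have "finite F" using \<open>finite Z\<close> by (simp add: F_def)
    define f where "f A = (\<Prod>t\<in>F. A $$ (0, 0) + A $$ (1, 1) - t)" for A :: "complex mat"
    have "f \<in> polynomial_functions 2"
      unfolding f_def by (intro polynomial_functions_prod \<open>finite F\<close> polynomial_functions_diff
          polynomial_functions.intros) auto
    obtain t where "t \<notin> F" using \<open>finite F\<close> ex_new_if_finite[OF infinite_UNIV_char_0] by blast
    \<comment> \<open>A companion matrix realizes any trace \<open>t\<close> with determinant
      1.\<close>
    then have "mat2 t (-1) 1 0 \<in> SL 2" "f (mat2 t (-1) 1 0) \<noteq> 0"
      using \<open>finite F\<close> by (auto simp: SL_def det_mat2 f_def)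
    from borel_propertyD[OF assms(1,2) _ \<gamma>(1) \<open>\<gamma> \<noteq> \<one>\<close> \<open>f \<in> polynomial_functions 2\<close> this]
    obtain \<phi> where \<phi>: "\<phi> \<in> hom G (SL_group 2)" "f (\<phi> \<gamma>) \<noteq> 0" by auto
    have tr: "\<phi> \<gamma> $$ (0, 0) + \<phi> \<gamma> $$ (1, 1) \<notin> F"
      using \<phi>(2) \<open>finite F\<close> by (auto simp: f_def)
    then have "\<phi> \<gamma> $$ (0, 0) + \<phi> \<gamma> $$ (1, 1) \<notin> {2, -2}" by (auto simp: F_def)
    from diagonalize_mat2[OF hom_SL_D(1,2)[OF \<phi>(1) \<gamma>(1)] this] obtain z P Q where z: "z \<noteq> 0" "z\<^sup>2 \<noteq> 1"
      "\<phi> \<gamma> $$ (0, 0) + \<phi> \<gamma> $$ (1, 1) = z + 1 / z" and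
      PQ: "P \<in> carrier_mat 2 2" "Q \<in> carrier_mat 2 2" "P * Q = 1\<^sub>m 2" "Q * P = 1\<^sub>m 2"
      and diag: "Q * \<phi> \<gamma> * P = hyp z" by metis
    define \<psi> where "\<psi> g = Q * \<phi> g * P" for g
    have \<psi>: "\<psi> \<in> hom G (SL_group 2)" "\<psi> \<gamma> = hyp z"
      using conj_hom_SL[OF \<phi>(1) PQ] diag by (simp_all add: \<psi>_def[abs_def])
    have "\<exists>s\<in>{a, b}. \<exists>u\<in>{a, b}. \<exists>g\<in>M s u. \<exists>h\<in>M s u. nonvanishing (\<psi> (inv g \<otimes> h))"
      using exists_nonvanishing[OF \<psi>(1) ab \<gamma> \<psi>(2) z(1,2)] by (simp only: M_def)
    then obtain s u k h where "s \<in> {a, b}" "u \<in> {a, b}" "k \<in> M s u" "h \<in> M s u"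
      and "nonvanishing (\<psi> (inv k \<otimes> h))" by (elim bexE)
    moreover from this have "inv k \<otimes> h \<in> L"
      unfolding L_def by (intro UN_I[of s] UN_I[of u] UN_I[of k] UN_I[of h] singletonI)
    ultimately obtain g where g: "g \<in> L" "nonvanishing (\<psi> g)" by blast
    have g_carrier: "g \<in> carrier G" using g(1) L_carrier by blast
    note C = hom_SL_D(1)[OF \<psi>(1) g_carrier] hom_SL_D(1)[OF \<psi>(1) inv_closed[OF g_carrier]]
    have "\<psi> g * \<psi> (inv g) = 1\<^sub>m 2"
      using hom_SL_D(3)[OF \<psi>(1) g_carrier inv_closed[OF g_carrier]] g_carrier
        hom_one[OF \<psi>(1) is_group group_SL] by simp
    moreover have "\<psi> g \<in> SL 2" using hom_in_carrier[OF \<psi>(1) g_carrier] by simp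
    ultimately obtain P' Q' c where PQ': "P' \<in> carrier_mat 2 2" "Q' \<in> carrier_mat 2 2"
      "P' * Q' = 1\<^sub>m 2" "Q' * P' = 1\<^sub>m 2" and c: "c \<noteq> 0" "c \<noteq> 1" "Q' * hyp z * P' = hyp z"
      "Q' * (\<psi> g * hyp z * \<psi> (inv g)) * P' = hyp_conj z c"
      using hyp_conj_normal_form[OF _ g(2) C(2) _ z(1)] by metis
    \<comment> \<open>A second conjugation, which leaves the diagonal image of \<gamma> alone, also
      brings the conjugate of \<gamma> by \<open>g\<close> into normal form.\<close>
    define \<theta> where "\<theta> h = Q' * \<psi> h * P'" for h
    have "\<theta> \<in> hom G (SL_group 2)" using conj_hom_SL[OF \<psi>(1) PQ'] by (simp add: \<theta>_def[abs_def])
    moreover have "\<psi> (g \<otimes> \<gamma> \<otimes> inv g) = \<psi> g * hyp z * \<psi> (inv g)"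
      using g_carrier \<gamma>(1) hom_SL_D(3)[OF \<psi>(1)] \<psi>(2) by simp
    then have "\<theta> \<gamma> = hyp z" "\<theta> (g \<otimes> \<gamma> \<otimes> inv g) = hyp_conj z c"
      using c \<psi>(2) by (simp_all add: \<theta>_def)
    ultimately have "(z, c) \<in> conj_pairs G \<gamma> (g \<otimes> \<gamma> \<otimes> inv g)"
      using z(1) c(1,2) unfolding conj_pairs_def by blast
    then have "z \<in> Z" using g(1) unfolding Z_def by force
    then show False using tr z(3) by (auto simp: F_def)
  qed
  then obtain g where "g \<in> L" "infinite (fst ` conj_pairs G \<gamma> (g \<otimes> \<gamma> \<otimes> inv g))"
    using \<open>finite L\<close> unfolding Z_def by blast
  then show ?thesis
    using L_carrier \<gamma>(1) by (intro infinite_conj_pairs_imp_free) auto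
qed

theorem theorem1p3:
  fixes \<Gamma> :: "('a, 'b) monoid_scheme"
  assumes "group \<Gamma>"
    and "finitely_generated_group \<Gamma>"
    and "torsion_free_group \<Gamma>"
    and "borel_property \<Gamma>"
  shows "contains_nonabelian_free_group \<Gamma> \<or> is_free_abelian_group \<Gamma>"
proof (cases "contains_nonabelian_free_group \<Gamma>")
  case False
  interpret group \<Gamma> by fact
  note commute = borel_property_commute_square[OF assms(4,3)]
  have "a \<otimes>\<^bsub>\<Gamma>\<^esub> b = b \<otimes>\<^bsub>\<Gamma>\<^esub> a" if ab: "a \<in> carrier \<Gamma>" "b \<in> carrier \<Gamma>" for a b
  proof -
    have "a \<otimes>\<^bsub>\<Gamma>\<^esub> a \<otimes>\<^bsub>\<Gamma>\<^esub> (b \<otimes>\<^bsub>\<Gamma>\<^esub> b) = b \<otimes>\<^bsub>\<Gamma>\<^esub> b \<otimes>\<^bsub>\<Gamma>\<^esub> (a \<otimes>\<^bsub>\<Gamma>\<^esub> a)"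
      using borel_property_squares[OF assms(4,3) ab] False by blast
    \<comment> \<open>The squares are removed one at a time: first that of \<open>a\<close>, with
      the square of \<open>b\<close> as second element, then that of \<open>b\<close>.\<close>
    then have "a \<otimes>\<^bsub>\<Gamma>\<^esub> (b \<otimes>\<^bsub>\<Gamma>\<^esub> b) = b \<otimes>\<^bsub>\<Gamma>\<^esub> b \<otimes>\<^bsub>\<Gamma>\<^esub> a"
      using ab commute[of a "b \<otimes>\<^bsub>\<Gamma>\<^esub> b"] by simp
    then show ?thesis using commute[of b a] ab by simp
  qed
  then interpret comm_group \<Gamma> by unfold_locales
  show ?thesis using torsion_free_imp_is_free_abelian_group assms(2,3) by blast
qed simp

end
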